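(* Let $Y_h\subset Y$ be a conforming discretization space and set $$\Lambda_h:=\{\lambda_h=(\mathcal{W}[y_h],y_h'(0)) : y_h\in Y_h,\ y_h(0)=0\}.$$ Then $\Lambda_h\subset\Lambda$ and, for every $\alpha,\rho>0$, the bilinear form $b$ satisfies $$\sup_{0\neq y_h\in Y_h}\frac{b(y_h,\lambda_h)}{\|y_h\|_{Y_{\alpha,\rho}}}\ge k_0\|\lambda_h\|_{\Lambda}\quad\text{for all }\lambda_h\in\Lambda_h,\quad\text{with } k_0=\frac{1}{\sqrt{C_{\text{obs}}^2+\rho}}.$$
   Context: $\emptyset\neq\Omega\subset\mathbb{R}^d$, $d\ge 1$, is an open bounded domain with piecewise Lipschitz boundary; $\emptyset\neq\Omega_s$ is an open set with Lipschitz boundary $\partial\Omega_s$, compactly contained in $\Omega$; $\Gamma\subset\partial\Omega_s$ is a measurable subset; $0<T<\infty$. All function spaces are real; $y'$, $y''$ denote (distributional) time derivatives and $\Delta$ the Laplacian in the space variable. $H^1_0(\Omega)$ carries its standard Hilbert space inner product. $W:=\{y\in L^2(0,T;H^1_0(\Omega)) : y'\in L^2(0,T;L^2(\Omega)),\ y''\in L^2(0,T;H^{-1}(\Omega))\}$. The wave operator is $\mathcal{W}:W\to L^2(0,T;H^{-1}(\Omega))$, $\mathcal{W}[y]=y''-\Delta y$. Functions $y\in W$ satisfy $(y,y')\in C([0,T];L^2(\Omega))\times C([0,T];H^{-1}(\Omega))$, so $y(0)$ and $y'(0)$ are well-defined. $Y:=\{y\in W : \mathcal{W}[y]\in L^2(0,T;L^2(\Omega)),\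 y(0)\in H^1_0(\Omega),\ y'(0)\in L^2(\Omega)\}$, with norm $\|y\|_Y^2:=\|\mathcal{W}[y]\|^2_{L^2(0,T;L^2(\Omega))}+\|y(0)\|^2_{H^1_0(\Omega)}+\|y'(0)\|^2_{L^2(\Omega)}$. A conforming discretization space $Y_h\subset Y$ is a nontrivial finite-dimensional linear subspace of $Y$. The values of $y$ on $\Gamma\times(0,T)$ are understood in the sense of traces on $\partial\Omega_s$ of $y(t)\in H^1(\Omega_s)$, for a.e. $t$. $C_{\text{obs}}=C_{\text{obs}}(\Omega,\Omega_s,T)>0$ denotes a constant such that $\|y\|_{L^2(0,T;L^2(\Gamma))}\le C_{\text{obs}}\|y\|_Y$ for all $y\in Y$ (such a constant exists). $\Lambda:=L^2(0,T;L^2(\Omega))\times L^2(\Omega)$ with $\|\lambda\|_\Lambda^2=\|\lambda_1\|^2_{L^2(0,T;L^2(\Omega))}+\|\lambda_2\|^2_{L^2(\Omega)}$; $\Lambda_h$ carries the norm of $\Lambda$. $b(y,\lambda)=(\mathcal{W}[y],\lambda_1)_{L^2(0,T;L^2(\Omega))}+(y'(0),\lambda_2)_{L^2(\Omega)}$ for $y\in Y$, $\lambda=(\lambda_1,\lambda_2)\in\Lambda$, and for $\alpha,\rho>0$ $$\|y\|_{Y_{\alpha,\rho}}^2:=\|y\|^2_{L^2(0,T;L^2(\Gamma))}+\alpha\|y(0)\|^2_{H^1_0(\Omega)}+\rho\left[\|\mathcal{W}[y]\|^2_{L^2(0,T;L^2(\Omega))}+\|y'(0)\|^2_{L^2(\Omega)}\right].$$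 *)

theory Defs
  imports "HOL-Analysis.Analysis"
begin

text \<open>
  Elements of Lebesgue, Sobolev and Bochner spaces are represented by functions; two representatives
  of the same element agree almost everywhere. Values outside the domain under consideration
  (\<open>\<Omega>\<close> in space, the interval from \<open>0\<close> to \<open>T\<close> in time) are irrelevant. An operator on equivalence
  classes is rendered by choosing, with \<open>SOME\<close>, a representative of its value.
\<close>

section \<open>Lipschitz boundaries and surface measure\<close>

definition hyperplane_proj :: "'a::euclidean_space \<Rightarrow> 'a \<Rightarrow> 'a"
  where "hyperplane_proj e x = x - (x \<bullet> e) *\<^sub>R e"

text \<open>The graph function \<open>\<gamma>\<close> is only ever evaluated on the hyperplane orthogonal to \<open>e\<close>.\<close>

definition lipschitz_boundary :: "'a::euclidean_space set \<Rightarrow> bool"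
  where "lipschitz_boundary U \<longleftrightarrow>
    (\<forall>p\<in>frontier U. \<exists>e \<gamma> L r. norm e = 1 \<and> L-lipschitz_on {x. x \<bullet> e = 0} \<gamma> \<and> 0 < r \<and>
       (\<forall>x\<in>ball p r. x \<in> U \<longleftrightarrow> \<gamma> (hyperplane_proj e x) < x \<bullet> e))"

text \<open>A graph of a Lipschitz function over a compact piece of a hyperplane, where the piece is the
  closure of its interior relative to the hyperplane.\<close>

definition lipschitz_piece :: "'a::euclidean_space set \<Rightarrow> bool"
  where "lipschitz_piece S \<longleftrightarrow>
    (\<exists>e \<gamma> L K. norm e = 1 \<and> L-lipschitz_on K \<gamma> \<and> compact K \<and> K \<subseteq> {x. x \<bullet> e = 0} \<and>
       K = closure (top_of_set {x. x \<bullet> e = 0} interior_of K) \<and>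
       S = (\<lambda>x. x + \<gamma> x *\<^sub>R e) ` K)"

definition piecewise_lipschitz_boundary :: "'a::euclidean_space set \<Rightarrow> bool"
  where "piecewise_lipschitz_boundary U \<longleftrightarrow>
    (\<exists>\<S>. finite \<S> \<and> (\<forall>S\<in>\<S>. lipschitz_piece S) \<and> frontier U = \<Union>\<S>)"

text \<open>
  The \<open>s\<close>-dimensional Hausdorff outer measure, normalized so that it is Lebesgue measure for
  \<open>s\<close>-dimensional surfaces. The empty set is treated separately because \<open>diameter {} = 0\<close> and
  \<open>0 ^ 0 = 1\<close>; for \<open>s = 0\<close> this gives counting measure.
\<close>

definition hausdorff_pre :: "nat \<Rightarrow> 'a::metric_space set \<Rightarrow> ennreal"
  where "hausdorff_pre s A =
    (if A = {} then 0 else ennreal (unit_ball_vol (real s) * (diameter A / 2) ^ s))"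

definition hausdorff_outer :: "nat \<Rightarrow> 'a::metric_space set \<Rightarrow> ennreal"
  where "hausdorff_outer s A =
    (SUP \<delta>\<in>{0<..}. INF C\<in>{C :: nat \<Rightarrow> 'a set. A \<subseteq> (\<Union>i. C i) \<and> (\<forall>i. bounded (C i) \<and> diameter (C i) \<le> \<delta>)}.
       \<Sum>i. hausdorff_pre s (C i))"

text \<open>The measure on all Caratheodory-measurable sets.\<close>

definition hausdorff_measure :: "nat \<Rightarrow> 'a::metric_space measure"
  where "hausdorff_measure s =
    measure_of UNIV (lambda_system UNIV (Pow UNIV) (hausdorff_outer s)) (hausdorff_outer s)"

abbreviation surface_measure :: "'a::euclidean_space measure"
  where "surface_measure \<equiv> hausdorff_measure (DIM('a) - 1)"

section \<open>Lebesgue and Sobolev spaces\<close>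

definition L2 :: "'x measure \<Rightarrow> ('x \<Rightarrow> real) set"
  where "L2 M = {f \<in> borel_measurable M. integrable M (\<lambda>x. (f x)\<^sup>2)}"

definition L2_inner :: "'x measure \<Rightarrow> ('x \<Rightarrow> real) \<Rightarrow> ('x \<Rightarrow> real) \<Rightarrow> real"
  where "L2_inner M f g = (LINT x|M. f x * g x)"

definition L2_norm :: "'x measure \<Rightarrow> ('x \<Rightarrow> real) \<Rightarrow> real"
  where "L2_norm M f = sqrt (L2_inner M f f)"

abbreviation partial :: "'a::euclidean_space \<Rightarrow> ('a \<Rightarrow> real) \<Rightarrow> 'a \<Rightarrow> real"
  where "partial b f \<equiv> (\<lambda>x. frechet_derivative f (at x) b)"

primrec Ck :: "nat \<Rightarrow> ('a::euclidean_space \<Rightarrow> real) \<Rightarrow> bool"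
  where
    "Ck 0 f \<longleftrightarrow> continuous_on UNIV f"
  | "Ck (Suc k) f \<longleftrightarrow> f differentiable_on UNIV \<and> (\<forall>b\<in>Basis. Ck k (partial b f))"

definition smooth :: "('a::euclidean_space \<Rightarrow> real) \<Rightarrow> bool"
  where "smooth f \<longleftrightarrow> (\<forall>k. Ck k f)"

definition test_functions :: "'a::euclidean_space set \<Rightarrow> ('a \<Rightarrow> real) set"
  where "test_functions U =
    {\<phi>. smooth \<phi> \<and> compact (closure {x. \<phi> x \<noteq> 0}) \<and> closure {x. \<phi> x \<noteq> 0} \<subseteq> U}"

definition has_weak_partial ::
    "'a::euclidean_space set \<Rightarrow> 'a \<Rightarrow> ('a \<Rightarrow> real) \<Rightarrow> ('a \<Rightarrow> real) \<Rightarrow> bool"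
  where "has_weak_partial U b u g \<longleftrightarrow> (\<forall>\<phi>\<in>test_functions U.
    L2_inner (lebesgue_on U) u (partial b \<phi>) = - L2_inner (lebesgue_on U) g \<phi>)"

definition weak_partial ::
    "'a::euclidean_space set \<Rightarrow> 'a \<Rightarrow> ('a \<Rightarrow> real) \<Rightarrow> 'a \<Rightarrow> real"
  where "weak_partial U b u = (SOME g. g \<in> L2 (lebesgue_on U) \<and> has_weak_partial U b u g)"

definition H1 :: "'a::euclidean_space set \<Rightarrow> ('a \<Rightarrow> real) set"
  where "H1 U = {u \<in> L2 (lebesgue_on U).
    \<forall>b\<in>Basis. \<exists>g\<in>L2 (lebesgue_on U). has_weak_partial U b u g}"

definition grad_inner ::
    "'a::euclidean_space set \<Rightarrow> ('a \<Rightarrow> real) \<Rightarrow> ('a \<Rightarrow> real) \<Rightarrow> real"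
  where "grad_inner U u v =
    (\<Sum>b\<in>Basis. L2_inner (lebesgue_on U) (weak_partial U b u) (weak_partial U b v))"

definition H1_norm :: "'a::euclidean_space set \<Rightarrow> ('a \<Rightarrow> real) \<Rightarrow> real"
  where "H1_norm U u = sqrt (L2_inner (lebesgue_on U) u u + grad_inner U u u)"

definition H10 :: "'a::euclidean_space set \<Rightarrow> ('a \<Rightarrow> real) set"
  where "H10 U = {u \<in> H1 U. \<exists>\<phi>. (\<forall>n. \<phi> n \<in> test_functions U) \<and>
    (\<lambda>n::nat. H1_norm U (\<lambda>x. u x - \<phi> n x)) \<longlonglongrightarrow> 0}"

text \<open>\<open>U\<close> is bounded in all uses, so \<open>grad_inner\<close> is an inner product on \<open>H10 U\<close> (Poincare).\<close>

definition H10_norm :: "'a::euclidean_space set \<Rightarrow> ('a \<Rightarrow> real) \<Rightarrow> real"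
  where "H10_norm U u = sqrt (grad_inner U u u)"

text \<open>The dual space of \<open>H10 U\<close>. Only the values of a functional on \<open>H10 U\<close> matter.\<close>

definition Hm1 :: "'a::euclidean_space set \<Rightarrow> (('a \<Rightarrow> real) \<Rightarrow> real) set"
  where "Hm1 U = {F.
    (\<forall>u\<in>H10 U. \<forall>v\<in>H10 U. F (\<lambda>x. u x + v x) = F u + F v) \<and>
    (\<forall>c. \<forall>u\<in>H10 U. F (\<lambda>x. c * u x) = c * F u) \<and>
    (\<exists>C. \<forall>u\<in>H10 U. \<bar>F u\<bar> \<le> C * H10_norm U u)}"

definition Hm1_norm :: "'a::euclidean_space set \<Rightarrow> (('a \<Rightarrow> real) \<Rightarrow> real) \<Rightarrow> real"
  where "Hm1_norm U F = (SUP v\<in>{v \<in> H10 U. H10_norm U v \<le> 1}. \<bar>F v\<bar>)"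

text \<open>The canonical embedding of \<open>L2\<close> into \<open>Hm1\<close>.\<close>

definition L2_to_Hm1 ::
    "'a::euclidean_space set \<Rightarrow> ('a \<Rightarrow> real) \<Rightarrow> ('a \<Rightarrow> real) \<Rightarrow> real"
  where "L2_to_Hm1 U f = (\<lambda>v. L2_inner (lebesgue_on U) f v)"

definition laplacian ::
    "'a::euclidean_space set \<Rightarrow> ('a \<Rightarrow> real) \<Rightarrow> ('a \<Rightarrow> real) \<Rightarrow> real"
  where "laplacian U u = (\<lambda>v. - grad_inner U u v)"

text \<open>The trace is the continuous extension to \<open>H1 U\<close> of the restriction of smooth functions to the
  boundary.\<close>

definition has_trace ::
    "'a::euclidean_space set \<Rightarrow> ('a \<Rightarrow> real) \<Rightarrow> ('a \<Rightarrow> real) \<Rightarrow> bool"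
  where "has_trace U v g \<longleftrightarrow> g \<in> L2 (restrict_space surface_measure (frontier U)) \<and>
    (\<exists>\<phi>. (\<forall>n. smooth (\<phi> n)) \<and>
      (\<lambda>n::nat. H1_norm U (\<lambda>x. v x - \<phi> n x)) \<longlonglongrightarrow> 0 \<and>
      (\<lambda>n. L2_norm (restrict_space surface_measure (frontier U)) (\<lambda>x. g x - \<phi> n x)) \<longlonglongrightarrow> 0)"

definition trace_on :: "'a::euclidean_space set \<Rightarrow> ('a \<Rightarrow> real) \<Rightarrow> 'a \<Rightarrow> real"
  where "trace_on U v = (SOME g. has_trace U v g)"

section \<open>Functions of time with values in a normed function space\<close>

text \<open>Here \<open>V\<close> is a linear space of functions, \<open>nv\<close> its norm, and measurability is strong
  (Bochner) measurability.\<close>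

definition strongly_measurable ::
    "real \<Rightarrow> 'v::minus set \<Rightarrow> ('v \<Rightarrow> real) \<Rightarrow> (real \<Rightarrow> 'v) \<Rightarrow> bool"
  where "strongly_measurable T V nv u \<longleftrightarrow>
    (\<exists>s. (\<forall>n. simple_function (lebesgue_on {0<..<T}) (s n) \<and> s n ` {0<..<T} \<subseteq> V) \<and>
      (AE t in lebesgue_on {0<..<T}. (\<lambda>n::nat. nv (u t - s n t)) \<longlonglongrightarrow> 0))"

definition bochner_L2 ::
    "real \<Rightarrow> 'v::minus set \<Rightarrow> ('v \<Rightarrow> real) \<Rightarrow> (real \<Rightarrow> 'v) set"
  where "bochner_L2 T V nv = {u. (AE t in lebesgue_on {0<..<T}. u t \<in> V) \<and>
    strongly_measurable T V nv u \<and> integrable (lebesgue_on {0<..<T}) (\<lambda>t. (nv (u t))\<^sup>2)}"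

definition continuous_representative ::
    "real \<Rightarrow> 'v::minus set \<Rightarrow> ('v \<Rightarrow> real) \<Rightarrow> (real \<Rightarrow> 'v) \<Rightarrow> (real \<Rightarrow> 'v) \<Rightarrow> bool"
  where "continuous_representative T V nv u w \<longleftrightarrow>
    (\<forall>t\<in>{0..T}. w t \<in> V \<and> ((\<lambda>s. nv (w s - w t)) \<longlongrightarrow> 0) (at t within {0..T})) \<and>
    (AE t in lebesgue_on {0<..<T}. nv (w t - u t) = 0)"

definition initial_value ::
    "real \<Rightarrow> 'v::minus set \<Rightarrow> ('v \<Rightarrow> real) \<Rightarrow> (real \<Rightarrow> 'v) \<Rightarrow> 'v"
  where "initial_value T V nv u = (SOME w. continuous_representative T V nv u w) 0"

abbreviation L2L2 :: "real \<Rightarrow> 'a::euclidean_space set \<Rightarrow> (real \<Rightarrow> 'a \<Rightarrow> real) set"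
  where "L2L2 T \<Omega> \<equiv> bochner_L2 T (L2 (lebesgue_on \<Omega>)) (L2_norm (lebesgue_on \<Omega>))"

abbreviation L2H10 :: "real \<Rightarrow> 'a::euclidean_space set \<Rightarrow> (real \<Rightarrow> 'a \<Rightarrow> real) set"
  where "L2H10 T \<Omega> \<equiv> bochner_L2 T (H10 \<Omega>) (H10_norm \<Omega>)"

abbreviation L2Hm1 ::
    "real \<Rightarrow> 'a::euclidean_space set \<Rightarrow> (real \<Rightarrow> ('a \<Rightarrow> real) \<Rightarrow> real) set"
  where "L2Hm1 T \<Omega> \<equiv> bochner_L2 T (Hm1 \<Omega>) (Hm1_norm \<Omega>)"

definition L2L2_inner ::
    "real \<Rightarrow> 'a::euclidean_space set \<Rightarrow> (real \<Rightarrow> 'a \<Rightarrow> real) \<Rightarrow> (real \<Rightarrow> 'a \<Rightarrow> real) \<Rightarrow> real"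
  where "L2L2_inner T \<Omega> f g =
    (LINT t|lebesgue_on {0<..<T}. L2_inner (lebesgue_on \<Omega>) (f t) (g t))"

definition L2L2_norm :: "real \<Rightarrow> 'a::euclidean_space set \<Rightarrow> (real \<Rightarrow> 'a \<Rightarrow> real) \<Rightarrow> real"
  where "L2L2_norm T \<Omega> f = sqrt (L2L2_inner T \<Omega> f f)"

definition ae_zero :: "real \<Rightarrow> 'a::euclidean_space set \<Rightarrow> (real \<Rightarrow> 'a \<Rightarrow> real) \<Rightarrow> bool"
  where "ae_zero T \<Omega> y \<longleftrightarrow>
    (AE t in lebesgue_on {0<..<T}. AE x in lebesgue_on \<Omega>. y t x = 0)"

text \<open>
  The distributional derivative of an \<open>Hm1\<close>-valued function: an identity between two integrals with
  values in \<open>Hm1\<close>, hence an identity of real integrals after evaluation at each \<open>v\<close> in \<open>H10\<close>.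
\<close>

definition has_weak_time_deriv ::
    "real \<Rightarrow> 'a::euclidean_space set \<Rightarrow> (real \<Rightarrow> ('a \<Rightarrow> real) \<Rightarrow> real) \<Rightarrow>
      (real \<Rightarrow> ('a \<Rightarrow> real) \<Rightarrow> real) \<Rightarrow> bool"
  where "has_weak_time_deriv T \<Omega> F G \<longleftrightarrow>
    (\<forall>\<phi>\<in>test_functions {0<..<T}. \<forall>v\<in>H10 \<Omega>.
      (LINT t|lebesgue_on {0<..<T}. deriv \<phi> t * F t v) =
      - (LINT t|lebesgue_on {0<..<T}. \<phi> t * G t v))"

section \<open>The wave operator and its spaces\<close>

definition is_dt ::
    "real \<Rightarrow> 'a::euclidean_space set \<Rightarrow> (real \<Rightarrow> 'a \<Rightarrow> real) \<Rightarrow> (real \<Rightarrow> 'a \<Rightarrow> real) \<Rightarrow> bool"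
  where "is_dt T \<Omega> y w \<longleftrightarrow> w \<in> L2L2 T \<Omega> \<and>
    has_weak_time_deriv T \<Omega> (\<lambda>t. L2_to_Hm1 \<Omega> (y t)) (\<lambda>t. L2_to_Hm1 \<Omega> (w t))"

definition dt ::
    "real \<Rightarrow> 'a::euclidean_space set \<Rightarrow> (real \<Rightarrow> 'a \<Rightarrow> real) \<Rightarrow> real \<Rightarrow> 'a \<Rightarrow> real"
  where "dt T \<Omega> y = (SOME w. is_dt T \<Omega> y w)"

definition is_dtt ::
    "real \<Rightarrow> 'a::euclidean_space set \<Rightarrow> (real \<Rightarrow> 'a \<Rightarrow> real) \<Rightarrow>
      (real \<Rightarrow> ('a \<Rightarrow> real) \<Rightarrow> real) \<Rightarrow> bool"
  where "is_dtt T \<Omega> y q \<longleftrightarrow> q \<in> L2Hm1 T \<Omega> \<and>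
    has_weak_time_deriv T \<Omega> (\<lambda>t. L2_to_Hm1 \<Omega> (dt T \<Omega> y t)) q"

definition dtt ::
    "real \<Rightarrow> 'a::euclidean_space set \<Rightarrow> (real \<Rightarrow> 'a \<Rightarrow> real) \<Rightarrow> real \<Rightarrow> ('a \<Rightarrow> real) \<Rightarrow> real"
  where "dtt T \<Omega> y = (SOME q. is_dtt T \<Omega> y q)"

definition W_space :: "real \<Rightarrow> 'a::euclidean_space set \<Rightarrow> (real \<Rightarrow> 'a \<Rightarrow> real) set"
  where "W_space T \<Omega> =
    {y \<in> L2H10 T \<Omega>. (\<exists>w. is_dt T \<Omega> y w) \<and> (\<exists>q. is_dtt T \<Omega> y q)}"

definition wave ::
    "real \<Rightarrow> 'a::euclidean_space set \<Rightarrow> (real \<Rightarrow> 'a \<Rightarrow> real) \<Rightarrow> real \<Rightarrow> ('a \<Rightarrow> real) \<Rightarrow> real"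
  where "wave T \<Omega> y = (\<lambda>t v. dtt T \<Omega> y t v - laplacian \<Omega> (y t) v)"

definition is_wave_L2 ::
    "real \<Rightarrow> 'a::euclidean_space set \<Rightarrow> (real \<Rightarrow> 'a \<Rightarrow> real) \<Rightarrow> (real \<Rightarrow> 'a \<Rightarrow> real) \<Rightarrow> bool"
  where "is_wave_L2 T \<Omega> y f \<longleftrightarrow> f \<in> L2L2 T \<Omega> \<and>
    (AE t in lebesgue_on {0<..<T}. \<forall>v\<in>H10 \<Omega>. wave T \<Omega> y t v = L2_to_Hm1 \<Omega> (f t) v)"

text \<open>\<open>wave T \<Omega> y\<close> as an element of \<open>L2L2 T \<Omega>\<close>, for those \<open>y\<close> for which it is one.\<close>

definition wave_L2 ::
    "real \<Rightarrow> 'a::euclidean_space set \<Rightarrow> (real \<Rightarrow> 'a \<Rightarrow> real) \<Rightarrow> real \<Rightarrow> 'a \<Rightarrow> real"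
  where "wave_L2 T \<Omega> y = (SOME f. is_wave_L2 T \<Omega> y f)"

definition init0 ::
    "real \<Rightarrow> 'a::euclidean_space set \<Rightarrow> (real \<Rightarrow> 'a \<Rightarrow> real) \<Rightarrow> 'a \<Rightarrow> real"
  where "init0 T \<Omega> y = initial_value T (L2 (lebesgue_on \<Omega>)) (L2_norm (lebesgue_on \<Omega>)) y"

text \<open>\<open>y'(0)\<close> is a priori only an element of \<open>Hm1\<close>; \<open>init1_L2\<close> is this element viewed in \<open>L2\<close>.\<close>

definition init1 ::
    "real \<Rightarrow> 'a::euclidean_space set \<Rightarrow> (real \<Rightarrow> 'a \<Rightarrow> real) \<Rightarrow> ('a \<Rightarrow> real) \<Rightarrow> real"
  where "init1 T \<Omega> y =
    initial_value T (Hm1 \<Omega>) (Hm1_norm \<Omega>) (\<lambda>t. L2_to_Hm1 \<Omega> (dt T \<Omega> y t))"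

definition is_init1_L2 ::
    "real \<Rightarrow> 'a::euclidean_space set \<Rightarrow> (real \<Rightarrow> 'a \<Rightarrow> real) \<Rightarrow> ('a \<Rightarrow> real) \<Rightarrow> bool"
  where "is_init1_L2 T \<Omega> y g \<longleftrightarrow> g \<in> L2 (lebesgue_on \<Omega>) \<and>
    (\<forall>v\<in>H10 \<Omega>. init1 T \<Omega> y v = L2_to_Hm1 \<Omega> g v)"

definition init1_L2 ::
    "real \<Rightarrow> 'a::euclidean_space set \<Rightarrow> (real \<Rightarrow> 'a \<Rightarrow> real) \<Rightarrow> 'a \<Rightarrow> real"
  where "init1_L2 T \<Omega> y = (SOME g. is_init1_L2 T \<Omega> y g)"

definition Y_space :: "real \<Rightarrow> 'a::euclidean_space set \<Rightarrow> (real \<Rightarrow> 'a \<Rightarrow> real) set"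
  where "Y_space T \<Omega> = {y \<in> W_space T \<Omega>. (\<exists>f. is_wave_L2 T \<Omega> y f) \<and>
    init0 T \<Omega> y \<in> H10 \<Omega> \<and> (\<exists>g. is_init1_L2 T \<Omega> y g)}"

definition Y_norm :: "real \<Rightarrow> 'a::euclidean_space set \<Rightarrow> (real \<Rightarrow> 'a \<Rightarrow> real) \<Rightarrow> real"
  where "Y_norm T \<Omega> y =
    sqrt ((L2L2_norm T \<Omega> (wave_L2 T \<Omega> y))\<^sup>2 + (H10_norm \<Omega> (init0 T \<Omega> y))\<^sup>2 +
      (L2_norm (lebesgue_on \<Omega>) (init1_L2 T \<Omega> y))\<^sup>2)"

text \<open>The norm of the trace of \<open>y\<close> in the space of square integrable functions on \<open>\<Gamma>\<close> and time,
  where \<open>\<Gamma>\<close> is a part of the boundary of \<open>\<Omega>s\<close>.\<close>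

definition obs_norm ::
    "real \<Rightarrow> 'a::euclidean_space set \<Rightarrow> 'a set \<Rightarrow> (real \<Rightarrow> 'a \<Rightarrow> real) \<Rightarrow> real"
  where "obs_norm T \<Omega>s \<Gamma> y =
    sqrt (LINT t|lebesgue_on {0<..<T}.
      (L2_norm (restrict_space surface_measure \<Gamma>) (trace_on \<Omega>s (y t)))\<^sup>2)"

definition Y_weighted_norm ::
    "real \<Rightarrow> 'a::euclidean_space set \<Rightarrow> 'a set \<Rightarrow> 'a set \<Rightarrow> real \<Rightarrow> real \<Rightarrow>
      (real \<Rightarrow> 'a \<Rightarrow> real) \<Rightarrow> real"
  where "Y_weighted_norm T \<Omega> \<Omega>s \<Gamma> \<alpha> \<rho> y =
    sqrt ((obs_norm T \<Omega>s \<Gamma> y)\<^sup>2 + \<alpha> * (H10_norm \<Omega> (init0 T \<Omega> y))\<^sup>2 +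
      \<rho> * ((L2L2_norm T \<Omega> (wave_L2 T \<Omega> y))\<^sup>2 +
           (L2_norm (lebesgue_on \<Omega>) (init1_L2 T \<Omega> y))\<^sup>2))"

text \<open>Finite dimension and nontriviality refer to the space of equivalence classes.\<close>

definition conforming_discretization ::
    "real \<Rightarrow> 'a::euclidean_space set \<Rightarrow> (real \<Rightarrow> 'a \<Rightarrow> real) set \<Rightarrow> bool"
  where "conforming_discretization T \<Omega> Yh \<longleftrightarrow> Yh \<subseteq> Y_space T \<Omega> \<and>
    (\<forall>y\<in>Yh. \<forall>z\<in>Yh. (\<lambda>t x. y t x + z t x) \<in> Yh) \<and>
    (\<forall>c. \<forall>y\<in>Yh. (\<lambda>t x. c * y t x) \<in> Yh) \<and>
    (\<exists>B. finite B \<and> B \<subseteq> Yh \<and>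
      (\<forall>y\<in>Yh. \<exists>c. ae_zero T \<Omega> (\<lambda>t x. y t x - (\<Sum>e\<in>B. c e * e t x)))) \<and>
    (\<exists>y\<in>Yh. \<not> ae_zero T \<Omega> y)"

definition Lambda_space ::
    "real \<Rightarrow> 'a::euclidean_space set \<Rightarrow> ((real \<Rightarrow> 'a \<Rightarrow> real) \<times> ('a \<Rightarrow> real)) set"
  where "Lambda_space T \<Omega> = L2L2 T \<Omega> \<times> L2 (lebesgue_on \<Omega>)"

definition Lambda_norm ::
    "real \<Rightarrow> 'a::euclidean_space set \<Rightarrow> (real \<Rightarrow> 'a \<Rightarrow> real) \<times> ('a \<Rightarrow> real) \<Rightarrow> real"
  where "Lambda_norm T \<Omega> l =
    sqrt ((L2L2_norm T \<Omega> (fst l))\<^sup>2 + (L2_norm (lebesgue_on \<Omega>) (snd l))\<^sup>2)"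

definition bform ::
    "real \<Rightarrow> 'a::euclidean_space set \<Rightarrow> (real \<Rightarrow> 'a \<Rightarrow> real) \<Rightarrow>
      (real \<Rightarrow> 'a \<Rightarrow> real) \<times> ('a \<Rightarrow> real) \<Rightarrow> real"
  where "bform T \<Omega> y l =
    L2L2_inner T \<Omega> (wave_L2 T \<Omega> y) (fst l) +
    L2_inner (lebesgue_on \<Omega>) (init1_L2 T \<Omega> y) (snd l)"

definition Lambda_h ::
    "real \<Rightarrow> 'a::euclidean_space set \<Rightarrow> (real \<Rightarrow> 'a \<Rightarrow> real) set \<Rightarrow>
      ((real \<Rightarrow> 'a \<Rightarrow> real) \<times> ('a \<Rightarrow> real)) set"
  where "Lambda_h T \<Omega> Yh =
    {(wave_L2 T \<Omega> y, init1_L2 T \<Omega> y) | y. y \<in> Yh \<and> (AE x in lebesgue_on \<Omega>. init0 T \<Omega> y x = 0)}"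

end

theory Submission
  imports Defs
begin

text \<open>
  The inequality itself is obtained by a test with the obvious function. Let \<open>\<lambda>\<^sub>h\<close> be the pair
  of \<open>\<W>[y\<^sub>h]\<close> and \<open>y\<^sub>h'(0)\<close>, with \<open>y\<^sub>h(0) = 0\<close>. Then \<open>b(y\<^sub>h, \<lambda>\<^sub>h)\<close> is the square of the norm
  of \<open>\<lambda>\<^sub>h\<close>. Since \<open>y\<^sub>h(0) = 0\<close>, the norm of \<open>y\<^sub>h\<close> in \<open>Y\<close> is the norm of \<open>\<lambda>\<^sub>h\<close> as well, the
  \<open>\<alpha>\<close>-term of the weighted norm drops out, and the observation term is at most \<open>C\<^sub>o\<^sub>b\<^sub>s\<^sup>2\<close> times
  the squared norm of \<open>\<lambda>\<^sub>h\<close>. The weighted norm of \<open>y\<^sub>h\<close> is therefore at most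
  \<open>sqrt (C\<^sub>o\<^sub>b\<^sub>s\<^sup>2 + \<rho>)\<close> times the norm of \<open>\<lambda>\<^sub>h\<close>, and the quotient is at least \<open>k\<^sub>0\<close> times it
  (\<open>quotient_lower_bound\<close>).

  Most of the work concerns the passage between functions and equivalence classes. Weak derivatives,
  the wave operator and the initial values are arbitrarily chosen representatives, so every statement
  of the form "the class is zero, hence so is its derivative" rests on a uniqueness argument. There are
  two of them: \<open>y\<^sub>h(0) = 0\<close> almost everywhere has to give a vanishing norm of the gradient
  (\<open>H10_norm_AE_zero\<close>), and if \<open>y\<^sub>h\<close> itself is zero almost everywhere, so that it is not
  admissible in the supremum, then \<open>\<lambda>\<^sub>h\<close> has to vanish (\<open>wave_L2_ae_zero\<close>, \<open>init1_L2_AE_zero\<close>),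
  and the supremum is nonnegative because all its quotients are zero.

  Both follow from the fundamental lemma of the calculus of variations, proved here for a countable
  family of test functions: products of one-dimensional bumps made of \<open>exp (-1/t)\<close>, supported on boxes
  with rational corners (\<open>AE_zero_if_orthogonal_to_bumps\<close>). Countability matters in space-time:
  testing in time gives, for each test function in space, an exceptional set of times, and these
  sets must have a common null set as their union. Integration by parts shows that the bumps belong to
  \<open>H10\<close>, where the functionals in \<open>Hm1\<close> can be evaluated at them.
\<close>

section \<open>Closure properties of smooth functions\<close>

lemma partial_eqI: "(f has_derivative f') (at x) \<Longrightarrow> frechet_derivative f (at x) b = f' b"
  by (metis frechet_derivative_at)

lemma Ck_Suc_imp_Ck: "Ck (Suc k) f \<Longrightarrow> Ck k f"
  by (induction k arbitrary: f) (auto simp: differentiable_imp_continuous_on)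

lemma Ck_differentiable: "Ck (Suc k) f \<Longrightarrow> f differentiable (at x)"
  by (simp add: differentiable_on_def)

lemma Ck_const: "Ck k (\<lambda>x. c)"
proof (induction k arbitrary: c)
  case (Suc k)
  have "partial b (\<lambda>x::'a. c) = (\<lambda>x. 0)" for b :: 'a
    by (rule ext, rule partial_eqI) (rule has_derivative_const)
  with Suc show ?case by (simp)
qed simp

lemma Ck_add: "Ck k f \<Longrightarrow> Ck k g \<Longrightarrow> Ck k (\<lambda>x. f x + g x)"
proof (induction k arbitrary: f g)
  case (Suc k)
  have df: "(f has_derivative frechet_derivative f (at x)) (at x)"
    and dg: "(g has_derivative frechet_derivative g (at x)) (at x)" for x
    using Suc.prems Ck_differentiable frechet_derivative_works by blast+
  have "partial b (\<lambda>x. f x + g x) = (\<lambda>x. partial b f x + partial b g x)" for b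
    by (rule ext, rule partial_eqI) (rule has_derivative_add[OF df dg])
  with Suc show ?case by (simp add: differentiable_on_add)
qed (auto intro: continuous_intros)

lemma Ck_mult: "Ck k f \<Longrightarrow> Ck k g \<Longrightarrow> Ck k (\<lambda>x. f x * g x)"
proof (induction k arbitrary: f g)
  case (Suc k)
  have df: "(f has_derivative frechet_derivative f (at x)) (at x)"
    and dg: "(g has_derivative frechet_derivative g (at x)) (at x)" for x
    using Suc.prems Ck_differentiable frechet_derivative_works by blast+
  have eq: "partial b (\<lambda>x. f x * g x) = (\<lambda>x. f x * partial b g x + partial b f x * g x)" for b
    by (rule ext, rule partial_eqI) (rule has_derivative_mult[OF df dg])
  have "Ck k (\<lambda>x. f x * partial b g x + partial b f x * g x)" if "b \<in> Basis" for b
    using Suc.prems that by (intro Ck_add Suc.IH) (auto intro: Ck_Suc_imp_Ck)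
  with Suc.prems eq show ?case by (simp add: differentiable_on_mult)
qed (auto intro: continuous_intros)

lemma Ck_prod: "(\<And>i. i \<in> I \<Longrightarrow> Ck k (f i)) \<Longrightarrow> Ck k (\<lambda>x. \<Prod>i\<in>I. f i x)"
  by (induction I rule: infinite_finite_induct) (auto intro: Ck_const Ck_mult)

text \<open>Differentiating \<open>D n (c + x \<bullet> v)\<close> yields a multiple of \<open>D (Suc n) (c + x \<bullet> v)\<close>. A sequence of
  functions, each the derivative of its predecessor, makes the induction on \<open>k\<close> close.\<close>
lemma Ck_compose_affine:
  fixes D :: "nat \<Rightarrow> real \<Rightarrow> real" and v :: "'a::euclidean_space"
  assumes D: "\<And>n t. (D n has_real_derivative D (Suc n) t) (at t)"
  shows "Ck k (\<lambda>x. D n (c + x \<bullet> v))"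
proof (induction k arbitrary: n)
  case 0
  have "continuous_on UNIV (D n)"
    using D by (intro DERIV_continuous_on) blast
  then show ?case
    by (auto intro!: continuous_intros continuous_on_compose2[of UNIV "D n"])
next
  case (Suc k)
  have d: "((\<lambda>x. D n (c + x \<bullet> v)) has_derivative (\<lambda>h. (h \<bullet> v) * D (Suc n) (c + x \<bullet> v))) (at x)" for x
  proof -
    have "((\<lambda>x. c + x \<bullet> v) has_derivative (\<lambda>h. h \<bullet> v)) (at x)"
      by (auto intro!: derivative_eq_intros)
    from DERIV_compose_FDERIV[OF D this] show ?thesis by simp
  qed
  have "partial b (\<lambda>x. D n (c + x \<bullet> v)) = (\<lambda>x. (b \<bullet> v) * D (Suc n) (c + x \<bullet> v))" for b
    by (rule ext, rule partial_eqI[OF d])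
  moreover have "Ck k (\<lambda>x. (b \<bullet> v) * D (Suc n) (c + x \<bullet> v))" for b
    by (intro Ck_mult Ck_const Suc)
  moreover have "(\<lambda>x. D n (c + x \<bullet> v)) differentiable_on UNIV"
    using d by (auto simp: differentiable_on_def differentiable_def)
  ultimately show ?case by simp
qed

section \<open>A countable family of smooth bumps\<close>

text \<open>The \<open>n\<close>-th derivative of \<open>exp (-1/t)\<close> for \<open>t > 0\<close> is a polynomial in \<open>1/t\<close> times \<open>exp (-1/t)\<close>.
  With \<open>s = 1/t\<close> one has \<open>ds/dt = - s\<^sup>2\<close>, which is the origin of the factor \<open>monom 1 2\<close>.\<close>
primrec theta_poly :: "nat \<Rightarrow> real poly" where
  "theta_poly 0 = 1"
| "theta_poly (Suc n) = monom 1 2 * (theta_poly n - pderiv (theta_poly n))"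

definition theta_deriv :: "nat \<Rightarrow> real \<Rightarrow> real" where
  "theta_deriv n t = (if t \<le> 0 then 0 else poly (theta_poly n) (inverse t) * exp (- inverse t))"

abbreviation theta :: "real \<Rightarrow> real" where "theta \<equiv> theta_deriv 0"

text \<open>The power \<open>s ^ k\<close> is there for the induction on the polynomial, which shifts one factor \<open>s\<close> at a
  time; the case \<open>k = 1\<close> gives differentiability of \<open>theta_deriv n\<close> at \<open>0\<close>.\<close>
lemma poly_times_exp_neg_tendsto_0: "((\<lambda>s::real. s ^ k * poly p s * exp (- s)) \<longlongrightarrow> 0) at_top"
proof (induction p arbitrary: k)
  case (pCons a p)
  have "((\<lambda>s::real. a * (s ^ k / exp s) + s ^ Suc k * poly p s * exp (- s)) \<longlongrightarrow> a * 0 + 0) at_top"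
    by (intro tendsto_intros tendsto_power_div_exp_0 pCons.IH)
  then show ?case by (simp add: algebra_simps exp_minus field_simps)
qed simp

lemma theta_deriv_DERIV: "(theta_deriv n has_real_derivative theta_deriv (Suc n) t) (at t)"
proof -
  consider "t < 0" | "t = 0" | "t > 0" by linarith
  then show ?thesis
  proof cases
    case 1
    have "\<forall>\<^sub>F x in nhds t. theta_deriv n x = (\<lambda>_. 0) x"
      using eventually_nhds_in_open[of "{..<0}" t] 1
      by (auto simp: theta_deriv_def elim!: eventually_mono)
    then have "(theta_deriv n has_real_derivative 0) (at t) \<longleftrightarrow> ((\<lambda>_. 0) has_real_derivative (0::real)) (at t)"
      by (intro DERIV_cong_ev) auto
    with 1 show ?thesis by (simp add: theta_deriv_def)
  next
    case 3
    let ?f = "\<lambda>x. poly (theta_poly n) (inverse x) * exp (- inverse x)"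
    have "\<forall>\<^sub>F x in nhds t. theta_deriv n x = ?f x"
      using eventually_nhds_in_open[of "{0<..}" t] 3
      by (auto simp: theta_deriv_def elim!: eventually_mono)
    moreover have "(?f has_real_derivative theta_deriv (Suc n) t) (at t)"
      using 3 by (auto intro!: derivative_eq_intros DERIV_chain2[OF poly_DERIV]
          simp: theta_deriv_def poly_monom algebra_simps power2_eq_square)
    ultimately show ?thesis
      by (subst DERIV_cong_ev) auto
  next
    case 2
    have "((\<lambda>s. s ^ 1 * poly (theta_poly n) s * exp (- s)) \<longlongrightarrow> 0) at_top"
      by (rule poly_times_exp_neg_tendsto_0)
    then have lim: "((\<lambda>h. inverse h * poly (theta_poly n) (inverse h) * exp (- inverse h)) \<longlongrightarrow> 0) (at_right 0)"
      using filterlim_compose[OF _ filterlim_inverse_at_top_right] by fastforce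
    have "((\<lambda>h. theta_deriv n h / h) \<longlongrightarrow> 0) (at_right 0)"
      by (rule Lim_transform_eventually[OF lim])
        (auto simp: theta_deriv_def divide_simps eventually_at_right_less intro!: eventually_at_rightI[of 0 1])
    moreover have "((\<lambda>h. theta_deriv n h / h) \<longlongrightarrow> 0) (at_left 0)"
      by (rule Lim_transform_eventually[OF tendsto_const])
        (auto simp: theta_deriv_def intro!: eventually_at_leftI[of "-1" 0])
    ultimately have "((\<lambda>h. theta_deriv n h / h) \<longlongrightarrow> 0) (at 0)"
      using filterlim_split_at by blast
    with 2 show ?thesis by (simp add: has_field_derivative_iff theta_deriv_def)
  qed
qed

lemma theta_nonneg: "0 \<le> theta t" and theta_le_1: "theta t \<le> 1" and theta_nonpos: "t \<le> 0 \<Longrightarrow> theta t = 0"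
  by (auto simp: theta_deriv_def)

text \<open>Rescaling turns the smooth step into a sharp one. As the values stay between \<open>0\<close> and \<open>1\<close>,
  integrals against the bumps below converge to integrals over boxes.\<close>
lemma theta_scaled_tendsto: "(\<lambda>m. theta (real (Suc m) * t)) \<longlonglongrightarrow> indicator {0<..} t"
proof (cases "t > 0")
  case True
  have "(\<lambda>m. exp (- (inverse (real (Suc m)) * inverse t))) \<longlonglongrightarrow> exp (- (0 * inverse t))"
    by (intro tendsto_intros LIMSEQ_inverse_real_of_nat)
  with True show ?thesis by (simp add: theta_deriv_def mult_le_0_iff add_nonneg_pos)
next
  case False
  then show ?thesis by (simp add: theta_nonpos mult_nonneg_nonpos)
qed

definition bump :: "'a::euclidean_space \<Rightarrow> 'a \<Rightarrow> nat \<Rightarrow> 'a \<Rightarrow> real" where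
  "bump a b m x = (\<Prod>i\<in>Basis. theta (real (Suc m) * (x \<bullet> i - a \<bullet> i)) * theta (real (Suc m) * (b \<bullet> i - x \<bullet> i)))"

lemma smooth_bump: "smooth (bump a b m)"
proof -
  have "Ck k (\<lambda>x. theta (real (Suc m) * (x \<bullet> i - a \<bullet> i)))" for k i
    using Ck_compose_affine[of theta_deriv, OF theta_deriv_DERIV, of k 0 "- (real (Suc m) * (a \<bullet> i))" "real (Suc m) *\<^sub>R i"]
    by (simp add: algebra_simps)
  moreover have "Ck k (\<lambda>x. theta (real (Suc m) * (b \<bullet> i - x \<bullet> i)))" for k i
    using Ck_compose_affine[of theta_deriv, OF theta_deriv_DERIV, of k 0 "real (Suc m) * (b \<bullet> i)" "- real (Suc m) *\<^sub>R i"]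
    by (simp add: algebra_simps)
  ultimately show ?thesis
    unfolding smooth_def bump_def by (intro allI Ck_prod Ck_mult) auto
qed

lemma bump_eq_0: "x \<notin> box a b \<Longrightarrow> bump a b m x = 0"
proof -
  assume "x \<notin> box a b"
  then obtain i where "i \<in> Basis" "x \<bullet> i - a \<bullet> i \<le> 0 \<or> b \<bullet> i - x \<bullet> i \<le> 0"
    by (auto simp: mem_box not_less)
  then show ?thesis
    unfolding bump_def
    by (intro prod_zero) (auto intro!: bexI[of _ i] theta_nonpos simp: mult_le_0_iff)
qed

lemma bump_nonneg: "0 \<le> bump a b m x"
  unfolding bump_def by (intro prod_nonneg mult_nonneg_nonneg theta_nonneg)

lemma bump_le_1: "bump a b m x \<le> 1"
  unfolding bump_def by (intro prod_le_1 conjI mult_nonneg_nonneg mult_le_one theta_nonneg theta_le_1)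

lemma bump_tendsto: "(\<lambda>m. bump a b m x) \<longlonglongrightarrow> indicator (box a b) x"
proof -
  have "(\<lambda>m. bump a b m x) \<longlonglongrightarrow>
      (\<Prod>i\<in>Basis. indicator {0<..} (x \<bullet> i - a \<bullet> i) * indicator {0<..} (b \<bullet> i - x \<bullet> i))"
    unfolding bump_def by (intro tendsto_prod tendsto_mult theta_scaled_tendsto)
  also have "(\<Prod>i\<in>Basis. indicator {0<..} (x \<bullet> i - a \<bullet> i) * indicator {0<..} (b \<bullet> i - x \<bullet> i))
     = (indicator (box a b) x :: real)"
    by (auto simp: indicator_def mem_box intro!: prod_zero prod.neutral)
  finally show ?thesis .
qed

text \<open>A countable set of corners whose boxes still form a base of the topology.\<close>
definition rational_points :: "'a::euclidean_space set" where
  "rational_points = {a. \<forall>i\<in>Basis. a \<bullet> i \<in> \<rat>}"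

definition bumps :: "'a::euclidean_space set \<Rightarrow> ('a \<Rightarrow> real) set" where
  "bumps U = {bump a b m | a b m. a \<in> rational_points \<and> b \<in> rational_points \<and> cbox a b \<subseteq> U}"

lemma countable_rational_points: "countable (rational_points :: 'a::euclidean_space set)"
proof (rule countable_subset)
  let ?e = "\<lambda>f::'a \<Rightarrow> real. \<Sum>i\<in>Basis. f i *\<^sub>R i"
  show "(rational_points :: 'a set) \<subseteq> ?e ` (Basis \<rightarrow>\<^sub>E \<rat>)"
  proof
    fix a :: 'a assume "a \<in> rational_points"
    then show "a \<in> ?e ` (Basis \<rightarrow>\<^sub>E \<rat>)"
      by (intro image_eqI[of _ _ "restrict (\<lambda>i. a \<bullet> i) Basis"])
        (auto simp: euclidean_representation rational_points_def)
  qed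
  show "countable (?e ` (Basis \<rightarrow>\<^sub>E \<rat>))"
    by (intro countable_image countable_PiE countable_rat finite_Basis)
qed

lemma countable_bumps: "countable (bumps U)"
proof (rule countable_subset)
  let ?Q = "rational_points :: 'a set"
  show "bumps U \<subseteq> (\<lambda>(a, b, m). bump a b m) ` (?Q \<times> ?Q \<times> UNIV)"
    unfolding bumps_def by force
  show "countable ((\<lambda>(a, b, m). bump a b m) ` (?Q \<times> ?Q \<times> (UNIV :: nat set)))"
    by (intro countable_image countable_SIGMA countable_rational_points) auto
qed

lemma bumps_subset_test_functions: "bumps U \<subseteq> test_functions U"
proof
  fix \<phi> assume "\<phi> \<in> bumps U"
  then obtain a b m where ab: "\<phi> = bump a b m" "cbox a b \<subseteq> U" unfolding bumps_def by auto
  have sub: "closure {x. \<phi> x \<noteq> 0} \<subseteq> cbox a b"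
    using bump_eq_0 box_subset_cbox unfolding ab
    by (intro closure_minimal closed_cbox) blast
  then have "compact (closure {x. \<phi> x \<noteq> 0})"
    by (metis bounded_cbox bounded_subset closed_closure compact_eq_bounded_closed)
  with sub ab smooth_bump show "\<phi> \<in> test_functions U"
    by (auto simp: test_functions_def)
qed

section \<open>The fundamental lemma of the calculus of variations\<close>
lemma sets_borel_eq_rational_boxes:
  "sets (borel :: 'a::euclidean_space measure) =
    sigma_sets UNIV {box a b | a b. a \<in> rational_points \<and> b \<in> rational_points}"
    (is "_ = sigma_sets UNIV ?G")
proof (rule antisym)
  have countable: "countable ?G"
  proof (rule countable_subset)
    show "?G \<subseteq> (\<lambda>(a, b). box a b) ` (rational_points \<times> rational_points)" by auto
  qed (intro countable_image countable_SIGMA countable_rational_points)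
  have "S \<in> sigma_sets UNIV ?G" if "open S" for S :: "'a set"
  proof -
    have "S = \<Union>{B \<in> ?G. B \<subseteq> S}"
    proof (intro equalityI subsetI)
      fix x assume "x \<in> S"
      then obtain e where "e > 0" "ball x e \<subseteq> S" using \<open>open S\<close> openE by blast
      then show "x \<in> \<Union>{B \<in> ?G. B \<subseteq> S}"
        using rational_boxes[of e x] unfolding rational_points_def by simp (metis order_trans)
    qed auto
    also have "\<dots> \<in> sigma_sets UNIV ?G"
      by (rule sigma_sets_UNION) (use countable in \<open>auto intro: countable_subset[rotated]\<close>)
    finally show ?thesis .
  qed
  then show "sets borel \<subseteq> sigma_sets UNIV ?G"
    unfolding borel_def by (auto intro!: sigma_sets_mono)
  show "sigma_sets UNIV ?G \<subseteq> sets borel"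
    by (rule sets.sigma_sets_subset') auto
qed

lemma rational_points_max_min:
  assumes "a \<in> rational_points" "c \<in> rational_points"
  shows "(\<Sum>i\<in>Basis. max (a \<bullet> i) (c \<bullet> i) *\<^sub>R i) \<in> rational_points"
    and "(\<Sum>i\<in>Basis. min (a \<bullet> i) (c \<bullet> i) *\<^sub>R i) \<in> rational_points"
  using assms by (auto simp: rational_points_def max_def min_def)

text \<open>The boxes with rational corners form a generator of the Borel sets that is stable under
  intersections. The sets over which \<open>h\<close> has integral zero are closed under complements, thanks to
  the assumption on the whole space, and under countable disjoint unions. By Dynkin's theorem they are
  all Borel sets.\<close>
lemma AE_zero_if_integral_zero_on_rational_boxes:
  fixes h :: "'a::euclidean_space \<Rightarrow> real"
  assumes h: "integrable lborel h" and total: "(LINT x|lborel. h x) = 0"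
    and boxes: "\<And>a b. a \<in> rational_points \<Longrightarrow> b \<in> rational_points \<Longrightarrow> (LINT x:box a b|lborel. h x) = 0"
  shows "AE x in lborel. h x = 0"
proof (rule density_unique_real)
  have si: "set_integrable lborel A h" if "A \<in> sets borel" for A
    using h that unfolding set_integrable_def by (intro integrable_mult_indicator) auto
  let ?G = "{box a b | a b::'a. a \<in> rational_points \<and> b \<in> rational_points}"
  fix A :: "'a set" assume "A \<in> sets lborel"
  then have A: "A \<in> sigma_sets UNIV ?G" using sets_borel_eq_rational_boxes by auto
  have stable: "Int_stable ?G"
  proof (rule Int_stableI, elim CollectE exE conjE, goal_cases)
    case (1 A B a b c d)
    then show ?case
      unfolding 1 box_Int_box using rational_points_max_min by blast
  qed
  have "(LINT x:A|lborel. h x) = 0"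
    using stable subset_UNIV[of ?G, folded Pow_UNIV] A
  proof (induction rule: sigma_sets_induct_disjoint)
    case (compl B)
    then have B: "B \<in> sets borel" using sets_borel_eq_rational_boxes by auto
    have "(LINT x|lborel. h x) = (LINT x:B \<union> (UNIV - B)|lborel. h x)"
      by (simp add: set_lebesgue_integral_def)
    also have "\<dots> = (LINT x:B|lborel. h x) + (LINT x:UNIV - B|lborel. h x)"
      using B by (intro set_integral_Un si) auto
    finally show ?case using total compl by simp
  next
    case (union B)
    have B: "B i \<in> sets lborel" for i
      using union sets_borel_eq_rational_boxes by auto
    have "(LINT x:(\<Union>i. B i)|lborel. h x) = (\<Sum>i. (LINT x:B i|lborel. h x))"
      using union.hyps(1) B
      by (intro lebesgue_integral_countable_add si) (auto simp: disjoint_family_on_def)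
    then show ?case using union.IH by simp
  qed (use boxes in \<open>auto simp: set_lebesgue_integral_def\<close>)
  then show "(LINT x:A|lborel. h x) = (LINT x:A|lborel. 0)" by simp
qed (use h in auto)

text \<open>The bumps on a box increase to its indicator function, hence \<open>g\<close> has integral zero over each
  rational box whose closure lies in \<open>U\<close>. On such a box the preceding lemma applies, because the
  intersection with another rational box is again such a box. Countably many of them cover \<open>U\<close>.\<close>
lemma AE_zero_if_orthogonal_to_bumps:
  fixes g :: "'a::euclidean_space \<Rightarrow> real"
  assumes U: "open U" and g: "integrable (lebesgue_on U) g"
    and orth: "\<And>\<phi>. \<phi> \<in> bumps U \<Longrightarrow> (LINT x|lebesgue_on U. g x * \<phi> x) = 0"
  shows "AE x in lebesgue_on U. g x = 0"
proof -
  have Ul: "U \<in> sets lebesgue" using U by auto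
  \<comment> \<open>The Dynkin argument needs a Borel function, but \<open>g\<close> is only Lebesgue measurable.\<close>
  define h0 where "h0 = (\<lambda>x. indicator U x * g x)"
  have h0: "integrable lebesgue h0"
    using g Ul integrable_restrict_space[of U lebesgue g] by (simp add: h0_def)
  obtain h where hm[measurable]: "h \<in> borel_measurable lborel" and hAE: "AE x in lborel. h0 x = h x"
    using completion_ex_borel_measurable_real[OF borel_measurable_integrable[OF h0]] by auto
  have hAE': "AE x in lebesgue. h0 x = h x" using hAE by (rule AE_completion)
  have hm': "h \<in> borel_measurable lebesgue" using hm by (rule measurable_completion)
  have "integrable lebesgue h"
    using integrable_cong_AE_imp[OF h0 hm'] hAE' by (auto elim: eventually_mono)
  then have h: "integrable lborel h" using integrable_completion[OF hm] by simp
  have h_bump: "(LINT x|lborel. h x * bump a b m x) = 0"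
    if "a \<in> rational_points" "b \<in> rational_points" "cbox a b \<subseteq> U" for a b m
  proof -
    have bm: "bump a b m \<in> borel_measurable borel"
      using smooth_bump[of a b m] unfolding smooth_def
      by (intro borel_measurable_continuous_onI) (metis Ck.simps(1))
    then have bm': "bump a b m \<in> borel_measurable lebesgue" by (auto intro: measurable_completion)
    have "(LINT x|lborel. h x * bump a b m x) = (LINT x|lebesgue. h x * bump a b m x)"
      using bm by (intro integral_completion[symmetric]) auto
    also have "\<dots> = (LINT x|lebesgue. h0 x * bump a b m x)"
      using h0 hm' bm' hAE' by (intro integral_cong_AE) auto
    also have "\<dots> = (LINT x|lebesgue_on U. g x * bump a b m x)"
      using Ul by (simp add: integral_restrict_space h0_def mult.assoc)
    also have "\<dots> = 0" using that by (intro orth) (auto simp: bumps_def)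
    finally show ?thesis .
  qed
  have h_box: "(LINT x:box a b|lborel. h x) = 0"
    if "a \<in> rational_points" "b \<in> rational_points" "cbox a b \<subseteq> U" for a b
  proof -
    have bm[measurable]: "bump a b m \<in> borel_measurable borel" for m
      using smooth_bump[of a b m] unfolding smooth_def
      by (intro borel_measurable_continuous_onI) (metis Ck.simps(1))
    have "(\<lambda>m. LINT x|lborel. h x * bump a b m x) \<longlonglongrightarrow> (LINT x|lborel. h x * indicator (box a b) x)"
    proof (rule integral_dominated_convergence)
      show "integrable lborel (\<lambda>x. \<bar>h x\<bar>)" using h by simp
      show "AE x in lborel. (\<lambda>m. h x * bump a b m x) \<longlonglongrightarrow> h x * indicator (box a b) x"
        by (intro AE_I2 tendsto_intros bump_tendsto)
      show "AE x in lborel. norm (h x * bump a b m x) \<le> \<bar>h x\<bar>" for m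
        by (intro AE_I2) (simp add: abs_mult bump_nonneg bump_le_1 mult_left_le)
    qed auto
    then show ?thesis
      using h_bump[OF that] LIMSEQ_unique[OF _ tendsto_const]
      by (auto simp: set_lebesgue_integral_def mult.commute)
  qed
  have AE_box: "AE x in lborel. x \<in> box c d \<longrightarrow> h x = 0"
    if cd: "c \<in> rational_points" "d \<in> rational_points" "cbox c d \<subseteq> U" for c d
  proof -
    have "AE x in lborel. indicator (box c d) x * h x = 0"
    proof (rule AE_zero_if_integral_zero_on_rational_boxes)
      show "integrable lborel (\<lambda>x. indicator (box c d) x * h x)"
        using integrable_mult_indicator[OF _ h, of "box c d"] by simp
      show "(LINT x|lborel. indicator (box c d) x * h x) = 0"
        using h_box[OF cd] by (simp add: set_lebesgue_integral_def)
      fix a b :: 'a assume ab: "a \<in> rational_points" "b \<in> rational_points"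
      have "cbox a b \<inter> cbox c d \<subseteq> U" using cd by auto
      then have "(LINT x:box a b \<inter> box c d|lborel. h x) = 0"
        using ab cd unfolding box_Int_box Int_interval
        by (intro h_box rational_points_max_min)
      then show "(LINT x:box a b|lborel. indicator (box c d) x * h x) = 0"
        by (simp add: set_lebesgue_integral_def indicator_inter_arith mult.assoc)
    qed
    then show ?thesis by eventually_elim (auto simp: indicator_def)
  qed
  let ?I = "{(c, d). c \<in> rational_points \<and> d \<in> rational_points \<and> cbox c d \<subseteq> U}"
  have "countable ?I"
    by (rule countable_subset[of _ "rational_points \<times> rational_points"])
      (auto intro: countable_rational_points)
  then have "AE x in lborel. \<forall>(c, d)\<in>?I. x \<in> box c d \<longrightarrow> h x = 0"
    using AE_box by (subst AE_ball_countable) auto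
  then have "AE x in lborel. x \<in> U \<longrightarrow> g x = 0"
    using hAE
  proof eventually_elim
    case (elim x)
    show ?case
    proof
      assume x: "x \<in> U"
      then obtain e where e: "e > 0" "cball x e \<subseteq> U" using U open_contains_cball by blast
      obtain c d where cd: "c \<in> rational_points" "d \<in> rational_points" "x \<in> box c d" "box c d \<subseteq> ball x e"
        using rational_boxes[OF e(1), of x] unfolding rational_points_def by auto
      have "cbox c d = closure (box c d)" using cd(3) by (subst closure_box) auto
      also have "\<dots> \<subseteq> cball x e"
        using cd(4) ball_subset_cball by (intro closure_minimal) (blast, simp)
      finally have "cbox c d \<subseteq> U" using e by auto
      then have "h x = 0" using elim(1) cd by auto
      then show "g x = 0" using elim(2) x by (simp add: h0_def)
    qed
  qed
  then have "AE x in lebesgue. x \<in> U \<longrightarrow> g x = 0" by (rule AE_completion)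
  then show ?thesis using Ul by (simp add: AE_restrict_space_iff)
qed

section \<open>Square integrable functions and integrability in time\<close>
lemma L2_mult_integrable:
  assumes "f \<in> L2 M" "g \<in> L2 M"
  shows "integrable M (\<lambda>x. f x * g x)"
proof (rule Bochner_Integration.integrable_bound)
  show "integrable M (\<lambda>x. (f x)\<^sup>2 + (g x)\<^sup>2)" using assms by (auto simp: L2_def)
  show "(\<lambda>x. f x * g x) \<in> borel_measurable M" using assms by (auto simp: L2_def)
  have "\<bar>a * b\<bar> \<le> a\<^sup>2 + b\<^sup>2" for a b :: real
  proof -
    have "2 * (\<bar>a\<bar> * \<bar>b\<bar>) \<le> \<bar>a\<bar>\<^sup>2 + \<bar>b\<bar>\<^sup>2" using sum_squares_bound[of "\<bar>a\<bar>" "\<bar>b\<bar>"] by simp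
    moreover have "0 \<le> \<bar>a\<bar> * \<bar>b\<bar>" by simp
    ultimately show ?thesis unfolding abs_mult power2_abs by linarith
  qed
  then show "AE x in M. norm (f x * g x) \<le> norm ((f x)\<^sup>2 + (g x)\<^sup>2)" by simp
qed

lemma L2_add: "f \<in> L2 M \<Longrightarrow> g \<in> L2 M \<Longrightarrow> (\<lambda>x. f x + g x) \<in> L2 M"
  using L2_mult_integrable[of f M g]
  by (auto simp: L2_def power2_sum mult.assoc intro!: Bochner_Integration.integrable_add)

lemma L2_cmult: "f \<in> L2 M \<Longrightarrow> (\<lambda>x. c * f x) \<in> L2 M"
  by (auto simp: L2_def power_mult_distrib)

lemma L2_diff: "f \<in> L2 M \<Longrightarrow> g \<in> L2 M \<Longrightarrow> f - g \<in> L2 M"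
  using L2_add[OF _ L2_cmult[of g M "-1"], of f] by (simp add: fun_diff_def)

lemma L2_inner_diff_left:
  assumes "f \<in> L2 M" "g \<in> L2 M" "v \<in> L2 M"
  shows "L2_inner M (f - g) v = L2_inner M f v - L2_inner M g v"
  using L2_mult_integrable[OF assms(1,3)] L2_mult_integrable[OF assms(2,3)]
  by (simp add: L2_inner_def left_diff_distrib)

lemma L2_inner_self_nonneg: "0 \<le> L2_inner M f f"
  unfolding L2_inner_def by (intro integral_nonneg_AE) auto

lemma L2_norm_power2: "(L2_norm M f)\<^sup>2 = L2_inner M f f"
  by (simp add: L2_norm_def L2_inner_self_nonneg)

text \<open>The usual discriminant argument for the quadratic \<open>r \<mapsto> \<parallel>f + r g\<parallel>\<^sup>2\<close>.\<close>
lemma L2_Cauchy_Schwarz: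
  assumes f: "f \<in> L2 M" and g: "g \<in> L2 M"
  shows "\<bar>L2_inner M f g\<bar> \<le> L2_norm M f * L2_norm M g"
proof -
  define A B C where "A = L2_inner M f f" and "B = L2_inner M f g" and "C = L2_inner M g g"
  have nonneg: "0 \<le> A + 2 * r * B + r\<^sup>2 * C" for r
  proof -
    have "0 \<le> L2_inner M (\<lambda>x. f x + r * g x) (\<lambda>x. f x + r * g x)" by (rule L2_inner_self_nonneg)
    also have "\<dots> = (LINT x|M. f x * f x + 2 * r * (f x * g x) + r\<^sup>2 * (g x * g x))"
      unfolding L2_inner_def by (intro Bochner_Integration.integral_cong) (auto simp: power2_eq_square algebra_simps)
    also have "\<dots> = A + 2 * r * B + r\<^sup>2 * C"
      using L2_mult_integrable[OF f f] L2_mult_integrable[OF f g] L2_mult_integrable[OF g g]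
      by (simp add: A_def B_def C_def L2_inner_def)
    finally show ?thesis .
  qed
  have C: "0 \<le> C" unfolding C_def by (rule L2_inner_self_nonneg)
  have "B\<^sup>2 \<le> A * C"
  proof (cases "C = 0")
    case True
    have "B = 0"
    proof (rule ccontr)
      assume "B \<noteq> 0"
      \<comment> \<open>At this point the function \<open>A + 2 r B\<close>, which is affine in \<open>r\<close>, has the value \<open>-1\<close>.\<close>
      with nonneg[of "- (A + 1) / (2 * B)"] True show False by (simp add: field_simps)
    qed
    with True show ?thesis by simp
  next
    case False
    with C have "C > 0" by simp
    \<comment> \<open>The minimum of the quadratic in \<open>r\<close>.\<close>
    with nonneg[of "- B / C"] show ?thesis
      by (simp add: field_simps power2_eq_square)
  qed
  then have "sqrt (B\<^sup>2) \<le> sqrt (A * C)" by (rule real_sqrt_le_mono)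
  then show ?thesis by (simp add: A_def B_def C_def L2_norm_def real_sqrt_mult)
qed

lemma borel_measurable_lebesgue_on_AE:
  fixes f g :: "'a::euclidean_space \<Rightarrow> real"
  assumes S: "S \<in> sets lebesgue" and f: "f \<in> borel_measurable (lebesgue_on S)"
    and eq: "AE x in lebesgue_on S. f x = g x"
  shows "g \<in> borel_measurable (lebesgue_on S)"
proof -
  have "(\<lambda>x. indicator S x *\<^sub>R f x) \<in> borel_measurable lebesgue"
    using S f by (simp add: borel_measurable_restrict_space_iff)
  moreover have "AE x in lebesgue. indicator S x *\<^sub>R f x = indicator S x *\<^sub>R g x"
    using eq S by (auto simp: AE_restrict_space_iff indicator_def elim!: eventually_mono)
  ultimately have "(\<lambda>x. indicator S x *\<^sub>R g x) \<in> borel_measurable lebesgue"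
    by (rule borel_measurable_AE)
  then show ?thesis using S by (simp add: borel_measurable_restrict_space_iff)
qed

lemma integrable_const_lebesgue_on_bounded:
  assumes "bounded S" "S \<in> sets lebesgue"
  shows "integrable (lebesgue_on S) (\<lambda>x. c::real)"
proof -
  have "S \<in> lmeasurable" using assms by (simp add: bounded_set_imp_lmeasurable)
  then have "integrable lebesgue (indicat_real S)"
    by (simp add: lmeasurable_iff_integrable)
  then show ?thesis using assms by (simp add: integrable_restrict_space)
qed

text \<open>Strong measurability makes every scalar function \<open>t \<mapsto> l (u t)\<close> measurable, as a limit almost
  everywhere of simple functions. The functional \<open>l\<close> will be the pairing with a fixed \<open>L2\<close> function, or
  the evaluation of elements of \<open>Hm1\<close> at a fixed test function.\<close>
lemma bochner_L2_pairing_integrable: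
  assumes u: "u \<in> bochner_L2 T V nv"
    and diff: "\<And>a b. a \<in> V \<Longrightarrow> b \<in> V \<Longrightarrow> \<bar>l a - l b\<bar> \<le> K * nv (a - b)"
    and bound: "\<And>a. a \<in> V \<Longrightarrow> \<bar>l a\<bar> \<le> K * nv a"
  shows "integrable (lebesgue_on {0<..<T}) (\<lambda>t. l (u t) :: real)"
proof -
  let ?M = "lebesgue_on {0<..<T}"
  have uV: "AE t in ?M. u t \<in> V" and int: "integrable ?M (\<lambda>t. (nv (u t))\<^sup>2)"
    using u by (auto simp: bochner_L2_def)
  obtain s where s: "\<And>n. simple_function ?M (s n)" "\<And>n. s n ` {0<..<T} \<subseteq> V"
    and lim: "AE t in ?M. (\<lambda>n::nat. nv (u t - s n t)) \<longlonglongrightarrow> 0"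
    using u by (auto simp: bochner_L2_def strongly_measurable_def)
  have [measurable]: "(\<lambda>t. l (s n t)) \<in> borel_measurable ?M" for n
    by (rule borel_measurable_simple_function[OF simple_function_compose1[OF s(1)]])
  have "AE t in ?M. lim (\<lambda>n. l (s n t)) = l (u t)"
    using uV lim AE_space
  proof eventually_elim
    case (elim t)
    have "(\<lambda>n. l (s n t)) \<longlonglongrightarrow> l (u t)"
    proof (rule LIM_zero_cancel, rule Lim_null_comparison)
      show "\<forall>\<^sub>F n in sequentially. norm (l (s n t) - l (u t)) \<le> K * nv (u t - s n t)"
      proof (rule always_eventually, rule allI)
        fix n
        have "s n t \<in> V" using s(2)[of n] elim(3) by auto
        then show "norm (l (s n t) - l (u t)) \<le> K * nv (u t - s n t)"
          using diff[OF elim(1), of "s n t"] by (metis abs_minus_commute real_norm_def)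
      qed
      show "(\<lambda>n. K * nv (u t - s n t)) \<longlonglongrightarrow> 0"
        using tendsto_mult_left[OF elim(2), of K] by simp
    qed
    then show ?case by (rule limI)
  qed
  then have meas: "(\<lambda>t. l (u t)) \<in> borel_measurable ?M"
    by (rule borel_measurable_lebesgue_on_AE[rotated 2]) (simp, measurable)
  show ?thesis
  proof (rule Bochner_Integration.integrable_bound[OF _ meas])
    show "integrable ?M (\<lambda>t. \<bar>K\<bar> * (1 + (nv (u t))\<^sup>2))"
      using int by (intro integrable_mult_right Bochner_Integration.integrable_add
          integrable_const_lebesgue_on_bounded) auto
    show "AE t in ?M. norm (l (u t)) \<le> norm (\<bar>K\<bar> * (1 + (nv (u t))\<^sup>2))"
      using uV
    proof eventually_elim
      case (elim t)
      have "x \<le> 1 + x\<^sup>2" for x :: real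
        using sum_squares_bound[of x 1] zero_le_power2[of x] by (smt (verit) mult.right_neutral one_power2)
      then have "\<bar>K\<bar> * \<bar>nv (u t)\<bar> \<le> \<bar>K\<bar> * (1 + (nv (u t))\<^sup>2)"
        by (intro mult_left_mono) (metis power2_abs, simp)
      then show ?case
        using bound[OF elim] abs_ge_self[of "K * nv (u t)"] by (simp add: abs_mult)
    qed
  qed
qed

section \<open>Integration by parts and weak derivatives\<close>

text \<open>The integral of the difference quotient \<open>q n\<close> in direction \<open>b\<close> vanishes by translation
  invariance, and the difference quotients converge to the partial derivative. They are dominated by the
  mean value theorem, since they vanish outside the support enlarged by the maximal step \<open>1\<close>.\<close>
lemma integral_compactly_supported_partial_eq_0:
  fixes f :: "'a::euclidean_space \<Rightarrow> real"
  assumes f: "f differentiable_on UNIV" and c: "continuous_on UNIV (partial b f)"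
    and b: "b \<in> Basis" and supp: "compact (closure {x. f x \<noteq> 0})"
  shows "(LINT x|lborel. partial b f x) = 0"
proof -
  have fm[measurable]: "f \<in> borel_measurable borel"
    using differentiable_imp_continuous_on[OF f] by (intro borel_measurable_continuous_onI)
  have pm[measurable]: "partial b f \<in> borel_measurable borel"
    using c by (intro borel_measurable_continuous_onI)
  have "bounded {x. f x \<noteq> 0}"
    using supp by (meson bounded_subset closure_subset compact_imp_bounded)
  then obtain R where R: "\<And>x. f x \<noteq> 0 \<Longrightarrow> norm x \<le> R"
    unfolding bounded_iff by auto
  have "bounded (partial b f ` cball 0 (R + 2))"
    by (intro compact_imp_bounded compact_continuous_image continuous_on_subset[OF c]) auto
  then obtain M where M: "\<And>x. norm x \<le> R + 2 \<Longrightarrow> \<bar>partial b f x\<bar> \<le> M"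
    unfolding bounded_iff by fastforce
  have deriv: "((\<lambda>t. f (x + t *\<^sub>R b)) has_real_derivative partial b f (x + t *\<^sub>R b)) (at t)" for x t
  proof -
    have "(f has_derivative frechet_derivative f (at (x + t *\<^sub>R b))) (at (x + t *\<^sub>R b))"
      using f frechet_derivative_works by (auto simp: differentiable_on_def)
    moreover have "((\<lambda>t. x + t *\<^sub>R b) has_derivative (\<lambda>h. h *\<^sub>R b)) (at t)"
      by (auto intro!: derivative_eq_intros)
    ultimately have "((\<lambda>t. f (x + t *\<^sub>R b)) has_derivative
        (\<lambda>h. frechet_derivative f (at (x + t *\<^sub>R b)) (h *\<^sub>R b))) (at t)"
      by (intro has_derivative_compose[of "\<lambda>t. x + t *\<^sub>R b" _ t UNIV f])
    moreover have lin: "linear (frechet_derivative f (at (x + t *\<^sub>R b)))"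
      using f by (intro linear_frechet_derivative) (auto simp: differentiable_on_def)
    from lin have "(\<lambda>h. frechet_derivative f (at (x + t *\<^sub>R b)) (h *\<^sub>R b))
        = (*) (partial b f (x + t *\<^sub>R b))"
      by (intro ext) (simp add: linear_cmul)
    ultimately show ?thesis by (simp add: has_field_derivative_def)
  qed
  define q where "q = (\<lambda>n x. (f (x + inverse (real (Suc n)) *\<^sub>R b) - f x) / inverse (real (Suc n)))"
  have step: "0 < inverse (real (Suc n))" "inverse (real (Suc n)) \<le> 1" for n
    by (auto simp: inverse_le_1_iff)
  have int_f: "integrable lborel f"
  proof -
    have "integrable lborel (\<lambda>x. indicator (closure {x. f x \<noteq> 0}) x *\<^sub>R f x)"
      by (intro borel_integrable_compact supp
          continuous_on_subset[OF differentiable_imp_continuous_on[OF f]]) simp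
    also have "(\<lambda>x. indicator (closure {x. f x \<noteq> 0}) x *\<^sub>R f x) = f"
      using closure_subset[of "{x. f x \<noteq> 0}"] by (auto simp: indicator_def fun_eq_iff)
    finally show ?thesis .
  qed
  have shift: "integrable lborel (\<lambda>x. f (x + v))" "(LINT x|lborel. f (x + v)) = (LINT x|lborel. f x)" for v
  proof -
    have "integrable (distr lborel borel ((+) v)) f" by (simp add: lborel_distr_plus int_f)
    then show "integrable lborel (\<lambda>x. f (x + v))"
      by (subst (asm) integrable_distr_eq) (auto simp: add.commute)
    have "(LINT x|distr lborel borel ((+) v). f x) = (LINT x|lborel. f (v + x))"
      by (intro integral_distr) auto
    then show "(LINT x|lborel. f (x + v)) = (LINT x|lborel. f x)"
      by (simp add: lborel_distr_plus add.commute)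
  qed
  have "(\<lambda>n. LINT x|lborel. q n x) \<longlonglongrightarrow> (LINT x|lborel. partial b f x)"
  proof (rule integral_dominated_convergence)
    show "AE x in lborel. (\<lambda>n. q n x) \<longlonglongrightarrow> partial b f x"
    proof (rule AE_I2)
      fix x
      have "((\<lambda>h. (f (x + h *\<^sub>R b) - f x) / h) \<longlongrightarrow> partial b f x) (at 0)"
        using deriv[of x 0] by (simp add: has_field_derivative_iff)
      moreover have "filterlim (\<lambda>n. inverse (real (Suc n))) (at 0) sequentially"
        using LIMSEQ_inverse_real_of_nat by (auto simp: filterlim_at)
      ultimately show "(\<lambda>n. q n x) \<longlonglongrightarrow> partial b f x"
        unfolding q_def by (rule filterlim_compose)
    qed
    show "integrable lborel (\<lambda>x. indicator (cball 0 (R + 1)) x *\<^sub>R M)"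
      by (intro borel_integrable_compact) auto
    show "AE x in lborel. norm (q n x) \<le> indicator (cball 0 (R + 1)) x *\<^sub>R M" for n
    proof (rule AE_I2)
      fix x
      let ?h = "inverse (real (Suc n))"
      show "norm (q n x) \<le> indicator (cball 0 (R + 1)) x *\<^sub>R M"
      proof (cases "norm x \<le> R + 1")
        case True
        obtain z where z: "0 < z" "z < ?h"
          "f (x + ?h *\<^sub>R b) - f (x + 0 *\<^sub>R b) = (?h - 0) * partial b f (x + z *\<^sub>R b)"
          using MVT2[of 0 ?h "\<lambda>t. f (x + t *\<^sub>R b)" "\<lambda>t. partial b f (x + t *\<^sub>R b)"] step(1) deriv by blast
        have q: "q n x = partial b f (x + z *\<^sub>R b)"
          using z(3) by (simp add: q_def field_simps)
        have "norm (x + z *\<^sub>R b) \<le> norm x + \<bar>z\<bar>"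
          using norm_triangle_ineq[of x "z *\<^sub>R b"] b by simp
        also have "\<dots> \<le> R + 2" using True z step(2)[of n] by linarith
        finally show ?thesis using M[of "x + z *\<^sub>R b"] True by (simp add: q indicator_def)
      next
        case False
        have "norm x \<le> norm (x + ?h *\<^sub>R b) + norm (?h *\<^sub>R b)"
          using norm_triangle_ineq4[of "x + ?h *\<^sub>R b" "?h *\<^sub>R b"] by simp
        then have "\<not> norm (x + ?h *\<^sub>R b) \<le> R" using False b step(2)[of n] by simp
        then have "f (x + ?h *\<^sub>R b) = 0" "f x = 0" using R False by force+
        then show ?thesis using False by (simp add: q_def)
      qed
    qed
  qed (auto simp: q_def)
  moreover have "(LINT x|lborel. q n x) = 0" for n
    using shift int_f by (simp add: q_def)
  ultimately have "(\<lambda>n. 0) \<longlonglongrightarrow> (LINT x|lborel. partial b f x)" by simp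
  then show ?thesis using LIMSEQ_unique tendsto_const by blast
qed

lemma integrable_continuous_on_bounded:
  fixes f :: "'a::euclidean_space \<Rightarrow> real"
  assumes U: "bounded U" "U \<in> sets lebesgue" and f: "continuous_on UNIV f"
  shows "integrable (lebesgue_on U) f"
proof -
  have "integrable lborel (\<lambda>x. indicator (closure U) x *\<^sub>R f x)"
    using U continuous_on_subset[OF f] by (intro borel_integrable_compact) (auto simp: compact_closure)
  then have "integrable lebesgue (\<lambda>x. indicator (closure U) x *\<^sub>R f x)"
    using integrable_completion[OF borel_measurable_integrable] by blast
  then have "integrable lebesgue (\<lambda>x. indicator U x *\<^sub>R (indicator (closure U) x *\<^sub>R f x))"
    using U by (intro integrable_mult_indicator[of U])
  also have "(\<lambda>x. indicator U x *\<^sub>R (indicator (closure U) x *\<^sub>R f x)) = (\<lambda>x. indicator U x *\<^sub>R f x)"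
    using closure_subset[of U] by (auto simp: indicator_def fun_eq_iff)
  finally show ?thesis using U by (simp add: integrable_restrict_space)
qed

lemma L2_continuous:
  fixes f :: "'a::euclidean_space \<Rightarrow> real"
  assumes "bounded U" "U \<in> sets lebesgue" "continuous_on UNIV f"
  shows "f \<in> L2 (lebesgue_on U)"
  unfolding L2_def
  using assms integrable_continuous_on_bounded[of U "\<lambda>x. (f x)\<^sup>2"] integrable_continuous_on_bounded[of U f]
  by (auto intro: continuous_on_power)

lemma test_function_Ck: "\<phi> \<in> test_functions U \<Longrightarrow> Ck k \<phi>"
  by (simp add: test_functions_def smooth_def)

lemma test_function_continuous: "\<phi> \<in> test_functions U \<Longrightarrow> continuous_on UNIV \<phi>"
  using test_function_Ck[of \<phi> U 0] by simp

lemma test_function_partial_continuous: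
  "\<phi> \<in> test_functions U \<Longrightarrow> b \<in> Basis \<Longrightarrow> continuous_on UNIV (partial b \<phi>)"
  using test_function_Ck[of \<phi> U "Suc 0"] by simp

lemma test_function_has_derivative:
  "\<phi> \<in> test_functions U \<Longrightarrow> (\<phi> has_derivative frechet_derivative \<phi> (at x)) (at x)"
  using Ck_differentiable[OF test_function_Ck] frechet_derivative_works by blast

lemma test_function_cmult:
  assumes "\<phi> \<in> test_functions U" shows "(\<lambda>x. c * \<phi> x) \<in> test_functions U"
proof -
  have sub: "closure {x. c * \<phi> x \<noteq> 0} \<subseteq> closure {x. \<phi> x \<noteq> 0}"
    by (intro closure_mono) auto
  then have "compact (closure {x. c * \<phi> x \<noteq> 0})"
    using assms by (metis (mono_tags, lifting) bounded_subset closed_closure compact_eq_bounded_closed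
        mem_Collect_eq test_functions_def)
  with sub assms show ?thesis
    by (auto simp: test_functions_def smooth_def intro!: Ck_mult Ck_const)
qed

lemma test_function_zero: "(\<lambda>x. 0) \<in> test_functions U"
  by (simp add: test_functions_def smooth_def Ck_const)

lemma test_function_integration_by_parts:
  fixes \<phi> :: "'a::euclidean_space \<Rightarrow> real"
  assumes U: "bounded U" "U \<in> sets lebesgue"
    and \<phi>: "\<phi> \<in> test_functions U" and \<psi>: "\<psi> \<in> test_functions U" and b: "b \<in> Basis"
  shows "L2_inner (lebesgue_on U) \<phi> (partial b \<psi>) = - L2_inner (lebesgue_on U) (partial b \<phi>) \<psi>"
proof -
  let ?f = "\<lambda>x. \<phi> x * \<psi> x"
  let ?D = "\<lambda>x. \<phi> x * partial b \<psi> x + partial b \<phi> x * \<psi> x"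
  have c: "continuous_on UNIV \<phi>" "continuous_on UNIV \<psi>"
    "continuous_on UNIV (partial b \<phi>)" "continuous_on UNIV (partial b \<psi>)"
    using \<phi> \<psi> b test_function_continuous test_function_partial_continuous by blast+
  have D: "partial b ?f = ?D"
    by (rule ext, rule partial_eqI)
      (rule has_derivative_mult[OF test_function_has_derivative[OF \<phi>] test_function_has_derivative[OF \<psi>]])
  have "closure {x. ?f x \<noteq> 0} \<subseteq> closure {x. \<phi> x \<noteq> 0}" by (intro closure_mono) auto
  then have "compact (closure {x. ?f x \<noteq> 0})"
    using \<phi> by (metis (mono_tags, lifting) bounded_subset closed_closure compact_eq_bounded_closed
        mem_Collect_eq test_functions_def)
  moreover have "Ck (Suc 0) ?f" by (intro Ck_mult test_function_Ck[OF \<phi>] test_function_Ck[OF \<psi>])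
  ultimately have "(LINT x|lborel. ?D x) = 0"
    using integral_compactly_supported_partial_eq_0[of ?f b] b D by simp
  moreover have "?D \<in> borel_measurable lborel"
    using c by (auto intro!: borel_measurable_continuous_onI continuous_intros)
  ultimately have "(LINT x|lebesgue. ?D x) = 0" by (simp add: integral_completion)
  moreover have "indicator U x *\<^sub>R ?D x = ?D x" for x
  proof (cases "x \<in> U")
    case False
    then have "\<phi> x = 0" "\<psi> x = 0"
      using \<phi> \<psi> closure_subset[of "{x. \<phi> x \<noteq> 0}"] closure_subset[of "{x. \<psi> x \<noteq> 0}"]
      by (auto simp: test_functions_def)
    then show ?thesis by simp
  qed simp
  ultimately have "(LINT x|lebesgue_on U. ?D x) = 0"
    using U by (subst integral_restrict_space) (simp, presburger)
  moreover have "integrable (lebesgue_on U) (\<lambda>x. \<phi> x * partial b \<psi> x)"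
    "integrable (lebesgue_on U) (\<lambda>x. partial b \<phi> x * \<psi> x)"
    using U c by (auto intro!: integrable_continuous_on_bounded continuous_intros)
  ultimately show ?thesis by (simp add: L2_inner_def)
qed

lemma L2_integrable:
  assumes "bounded U" "U \<in> sets lebesgue" "f \<in> L2 (lebesgue_on U)"
  shows "integrable (lebesgue_on U) f"
  using L2_mult_integrable[OF assms(3) L2_continuous[OF assms(1,2) continuous_on_const[of _ 1]]] by simp

lemma L2_inner_AE_zero_left: "AE x in M. f x = 0 \<Longrightarrow> L2_inner M f g = 0"
  unfolding L2_inner_def by (intro integral_eq_zero_AE) (auto elim: eventually_mono)

lemma L2_inner_AE_zero_right: "AE x in M. g x = 0 \<Longrightarrow> L2_inner M f g = 0"
  unfolding L2_inner_def by (intro integral_eq_zero_AE) (auto elim: eventually_mono)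

lemma L2_AE_zero_if_orthogonal_to_bumps:
  assumes "open U" "bounded U" "g \<in> L2 (lebesgue_on U)"
    and "\<And>\<phi>. \<phi> \<in> bumps U \<Longrightarrow> L2_inner (lebesgue_on U) g \<phi> = 0"
  shows "AE x in lebesgue_on U. g x = 0"
  using assms by (intro AE_zero_if_orthogonal_to_bumps L2_integrable) (auto simp: L2_inner_def)

lemma weak_partial_witness:
  assumes "g \<in> L2 (lebesgue_on U)" "has_weak_partial U b u g"
  shows "weak_partial U b u \<in> L2 (lebesgue_on U)" "has_weak_partial U b u (weak_partial U b u)"
  unfolding weak_partial_def using assms by (rule_tac someI2[of _ g]; simp)+

text \<open>Two weak derivatives of the same function have the same integrals against all test functions,
  hence agree by the fundamental lemma.\<close>
lemma weak_partial_AE_unique: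
  assumes U: "open U" "bounded U"
    and g: "g \<in> L2 (lebesgue_on U)" "has_weak_partial U b u g"
  shows "AE x in lebesgue_on U. weak_partial U b u x = g x"
proof -
  let ?w = "weak_partial U b u"
  note w = weak_partial_witness[OF g]
  have "AE x in lebesgue_on U. (?w - g) x = 0"
  proof (rule L2_AE_zero_if_orthogonal_to_bumps[OF U])
    fix \<phi> assume "\<phi> \<in> bumps U"
    then have \<phi>: "\<phi> \<in> test_functions U" using bumps_subset_test_functions by blast
    then have "L2_inner (lebesgue_on U) ?w \<phi> = L2_inner (lebesgue_on U) g \<phi>"
      using w g(2) unfolding has_weak_partial_def by (metis neg_equal_iff_equal)
    moreover have "\<phi> \<in> L2 (lebesgue_on U)"
      using U \<phi> by (intro L2_continuous test_function_continuous) auto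
    ultimately show "L2_inner (lebesgue_on U) (?w - g) \<phi> = 0"
      using w g by (simp add: L2_inner_diff_left)
  qed (intro L2_diff w g)
  then show ?thesis by simp
qed

lemma L2_zero: "(\<lambda>x. 0) \<in> L2 M"
  by (simp add: L2_def)

lemma weak_partial_AE_zero:
  assumes "open U" "bounded U" and u: "AE x in lebesgue_on U. u x = 0"
  shows "AE x in lebesgue_on U. weak_partial U b u x = 0"
  using assms by (intro weak_partial_AE_unique L2_zero)
    (auto simp: has_weak_partial_def L2_inner_AE_zero_left)

lemma grad_inner_AE_zero_left:
  assumes "open U" "bounded U" "AE x in lebesgue_on U. u x = 0"
  shows "grad_inner U u v = 0"
  using weak_partial_AE_zero[OF assms] by (simp add: grad_inner_def L2_inner_AE_zero_left)

lemma weak_partial_test_function: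
  assumes "open U" "bounded U" "\<phi> \<in> test_functions U" "b \<in> Basis"
  shows "partial b \<phi> \<in> L2 (lebesgue_on U)" "has_weak_partial U b \<phi> (partial b \<phi>)"
  using assms test_function_integration_by_parts[of U \<phi> _ b]
  by (auto simp: has_weak_partial_def intro: L2_continuous test_function_partial_continuous)

lemma test_functions_subset_H10:
  assumes U: "open U" "bounded U"
  shows "test_functions U \<subseteq> H10 U"
proof
  fix \<phi> assume \<phi>: "\<phi> \<in> test_functions U"
  have "\<phi> \<in> H1 U"
    using U \<phi> weak_partial_test_function[OF U \<phi>]
    by (auto simp: H1_def intro!: L2_continuous test_function_continuous)
  moreover have "H1_norm U (\<lambda>x. \<phi> x - \<phi> x) = 0"
    using grad_inner_AE_zero_left[OF U, of "\<lambda>x. 0"] by (simp add: H1_norm_def L2_inner_def)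
  ultimately show "\<phi> \<in> H10 U"
    using \<phi> by (auto simp: H10_def intro!: exI[of _ "\<lambda>n. \<phi>"])
qed

lemma H10_norm_AE_zero:
  assumes "open U" "bounded U" "AE x in lebesgue_on U. u x = 0"
  shows "H10_norm U u = 0"
  using grad_inner_AE_zero_left[OF assms] by (simp add: H10_norm_def)

lemma H10_norm_cmult_test_function:
  assumes U: "open U" "bounded U" and \<phi>: "\<phi> \<in> test_functions U"
  shows "H10_norm U (\<lambda>x. c * \<phi> x) = \<bar>c\<bar> * H10_norm U \<phi>"
proof -
  let ?M = "lebesgue_on U"
  have "L2_inner ?M (weak_partial U b (\<lambda>x. c * \<phi> x)) (weak_partial U b (\<lambda>x. c * \<phi> x))
      = c\<^sup>2 * L2_inner ?M (weak_partial U b \<phi>) (weak_partial U b \<phi>)" if b: "b \<in> Basis" for b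
  proof -
    have eq: "partial b (\<lambda>x. c * \<phi> x) x = c * partial b \<phi> x" for x
      by (rule partial_eqI)
        (rule has_derivative_mult_right[OF test_function_has_derivative[OF \<phi>]])
    note W = weak_partial_test_function[OF U \<phi> b]
      weak_partial_test_function[OF U test_function_cmult[OF \<phi>] b, of c]
    have [measurable]: "weak_partial U b \<phi> \<in> borel_measurable ?M"
      "weak_partial U b (\<lambda>x. c * \<phi> x) \<in> borel_measurable ?M"
      using weak_partial_witness(1)[OF W(1,2)] weak_partial_witness(1)[OF W(3,4)]
      by (simp_all add: L2_def)
    have "AE x in ?M. weak_partial U b (\<lambda>x. c * \<phi> x) x = c * weak_partial U b \<phi> x"
      using weak_partial_AE_unique[OF U W(1,2)] weak_partial_AE_unique[OF U W(3,4)]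
      by eventually_elim (simp add: eq)
    then have "L2_inner ?M (weak_partial U b (\<lambda>x. c * \<phi> x)) (weak_partial U b (\<lambda>x. c * \<phi> x))
      = (LINT x|?M. c\<^sup>2 * (weak_partial U b \<phi> x * weak_partial U b \<phi> x))"
      unfolding L2_inner_def
      by (intro integral_cong_AE) (auto simp: power2_eq_square elim!: eventually_mono)
    then show ?thesis by (simp add: L2_inner_def)
  qed
  then have "grad_inner U (\<lambda>x. c * \<phi> x) (\<lambda>x. c * \<phi> x) = c\<^sup>2 * grad_inner U \<phi> \<phi>"
    by (simp add: grad_inner_def sum_distrib_left)
  then show ?thesis by (simp add: H10_norm_def real_sqrt_mult)
qed

lemma H10_norm_nonneg: "0 \<le> H10_norm U u"
  by (simp add: H10_norm_def grad_inner_def sum_nonneg L2_inner_self_nonneg)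

lemma Hm1_diff: "F \<in> Hm1 U \<Longrightarrow> G \<in> Hm1 U \<Longrightarrow> F - G \<in> Hm1 U"
proof -
  assume F: "F \<in> Hm1 U" and G: "G \<in> Hm1 U"
  obtain C D where "\<And>u. u \<in> H10 U \<Longrightarrow> \<bar>F u\<bar> \<le> C * H10_norm U u"
    "\<And>u. u \<in> H10 U \<Longrightarrow> \<bar>G u\<bar> \<le> D * H10_norm U u"
    using F G by (fastforce simp: Hm1_def)
  then have "\<bar>F u - G u\<bar> \<le> (C + D) * H10_norm U u" if "u \<in> H10 U" for u
    using that abs_triangle_ineq4[of "F u" "G u"] by (fastforce simp: distrib_right)
  then have "\<exists>C. \<forall>u\<in>H10 U. \<bar>F u - G u\<bar> \<le> C * H10_norm U u" by blast
  with F G show ?thesis by (auto simp: Hm1_def right_diff_distrib)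
qed

text \<open>The norm of \<open>Hm1\<close> is a supremum over the unit ball of \<open>H10\<close>, so \<open>\<phi>\<close> has to be scaled into this
  ball. That \<open>H10_norm\<close> is homogeneous is itself a consequence of the uniqueness of weak derivatives.\<close>
lemma Hm1_evaluation_bound:
  assumes U: "open U" "bounded U" and \<phi>: "\<phi> \<in> test_functions U"
  obtains K where "\<And>F. F \<in> Hm1 U \<Longrightarrow> \<bar>F \<phi>\<bar> \<le> K * Hm1_norm U F"
proof
  fix F assume F: "F \<in> Hm1 U"
  \<comment> \<open>The summand \<open>1\<close> spares a case distinction on whether the norm of \<open>\<phi>\<close> is zero.\<close>
  define c where "c = 1 / (1 + H10_norm U \<phi>)"
  have c: "c > 0" using H10_norm_nonneg[of U \<phi>] by (simp add: c_def add_pos_nonneg)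
  have mem: "(\<lambda>x. c * \<phi> x) \<in> H10 U" and \<phi>': "\<phi> \<in> H10 U"
    using test_function_cmult[OF \<phi>] \<phi> test_functions_subset_H10[OF U] by blast+
  have "H10_norm U (\<lambda>x. c * \<phi> x) \<le> 1"
    using c H10_norm_nonneg[of U \<phi>]
    by (simp add: H10_norm_cmult_test_function[OF U \<phi>]) (simp add: c_def divide_simps)
  moreover obtain C where C: "\<And>u. u \<in> H10 U \<Longrightarrow> \<bar>F u\<bar> \<le> C * H10_norm U u"
    using F by (fastforce simp: Hm1_def)
  have "bdd_above ((\<lambda>v. \<bar>F v\<bar>) ` {v \<in> H10 U. H10_norm U v \<le> 1})"
  proof (rule bdd_aboveI2)
    fix v assume "v \<in> {v \<in> H10 U. H10_norm U v \<le> 1}"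
    then have v: "v \<in> H10 U" "H10_norm U v \<le> 1" by auto
    have "C * H10_norm U v \<le> \<bar>C\<bar> * H10_norm U v"
      by (intro mult_right_mono H10_norm_nonneg) simp
    also have "\<dots> \<le> \<bar>C\<bar> * 1" using v by (intro mult_left_mono) auto
    finally show "\<bar>F v\<bar> \<le> \<bar>C\<bar>" using C[OF v(1)] by simp
  qed
  ultimately have "\<bar>F (\<lambda>x. c * \<phi> x)\<bar> \<le> Hm1_norm U F"
    unfolding Hm1_norm_def using mem by (intro cSUP_upper) auto
  moreover have "F (\<lambda>x. c * \<phi> x) = c * F \<phi>" using F \<phi>' by (simp add: Hm1_def)
  ultimately have "c * \<bar>F \<phi>\<bar> \<le> Hm1_norm U F" using c by (simp add: abs_mult)
  then show "\<bar>F \<phi>\<bar> \<le> (1 + H10_norm U \<phi>) * Hm1_norm U F"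
    using H10_norm_nonneg[of U \<phi>] by (simp add: c_def divide_simps mult.commute split: if_splits)
qed

section \<open>The wave operator on functions that vanish almost everywhere\<close>
lemma L2L2_pairing_integrable:
  assumes w: "w \<in> L2L2 T \<Omega>" and v: "v \<in> L2 (lebesgue_on \<Omega>)"
  shows "integrable (lebesgue_on {0<..<T}) (\<lambda>t. L2_inner (lebesgue_on \<Omega>) (w t) v)"
proof (rule bochner_L2_pairing_integrable[OF w, where l = "\<lambda>a. L2_inner (lebesgue_on \<Omega>) a v"])
  fix a b assume "a \<in> L2 (lebesgue_on \<Omega>)" "b \<in> L2 (lebesgue_on \<Omega>)"
  then show "\<bar>L2_inner (lebesgue_on \<Omega>) a v - L2_inner (lebesgue_on \<Omega>) b v\<bar>
      \<le> L2_norm (lebesgue_on \<Omega>) v * L2_norm (lebesgue_on \<Omega>) (a - b)"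
    using L2_Cauchy_Schwarz[OF L2_diff v, of a b] v
    by (simp add: L2_inner_diff_left mult.commute)
next
  fix a assume "a \<in> L2 (lebesgue_on \<Omega>)"
  then show "\<bar>L2_inner (lebesgue_on \<Omega>) a v\<bar> \<le> L2_norm (lebesgue_on \<Omega>) v * L2_norm (lebesgue_on \<Omega>) a"
    using L2_Cauchy_Schwarz[OF _ v] by (simp add: mult.commute)
qed

lemma L2Hm1_evaluation_integrable:
  assumes \<Omega>: "open \<Omega>" "bounded \<Omega>" and q: "q \<in> L2Hm1 T \<Omega>" and v: "v \<in> test_functions \<Omega>"
  shows "integrable (lebesgue_on {0<..<T}) (\<lambda>t. q t v)"
proof -
  obtain K where K: "\<And>F. F \<in> Hm1 \<Omega> \<Longrightarrow> \<bar>F v\<bar> \<le> K * Hm1_norm \<Omega> F"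
    using Hm1_evaluation_bound[OF \<Omega> v] by blast
  show ?thesis
  proof (rule bochner_L2_pairing_integrable[OF q, where l = "\<lambda>F. F v"])
    fix F G assume "F \<in> Hm1 \<Omega>" "G \<in> Hm1 \<Omega>"
    then show "\<bar>F v - G v\<bar> \<le> K * Hm1_norm \<Omega> (F - G)"
      using K[OF Hm1_diff, of F G] by simp
  qed (use K in auto)
qed

text \<open>The fundamental lemma in time, for a fixed test function in space.\<close>
lemma weak_time_deriv_zero:
  assumes FG: "has_weak_time_deriv T \<Omega> F G" and v: "v \<in> H10 \<Omega>"
    and F: "AE t in lebesgue_on {0<..<T}. F t v = 0"
    and G: "integrable (lebesgue_on {0<..<T}) (\<lambda>t. G t v)"
  shows "AE t in lebesgue_on {0<..<T}. G t v = 0"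
proof (rule AE_zero_if_orthogonal_to_bumps[OF _ G])
  fix \<phi> :: "real \<Rightarrow> real" assume "\<phi> \<in> bumps {0<..<T}"
  then have "\<phi> \<in> test_functions {0<..<T}" using bumps_subset_test_functions by blast
  then have "(LINT t|lebesgue_on {0<..<T}. deriv \<phi> t * F t v) =
      - (LINT t|lebesgue_on {0<..<T}. \<phi> t * G t v)"
    using FG v by (simp add: has_weak_time_deriv_def)
  moreover have "(LINT t|lebesgue_on {0<..<T}. deriv \<phi> t * F t v) = 0"
    using F by (intro integral_eq_zero_AE) (auto elim: eventually_mono)
  ultimately show "(LINT t|lebesgue_on {0<..<T}. G t v * \<phi> t) = 0"
    by (simp add: mult.commute)
qed simp

text \<open>The exceptional set of times may depend on \<open>v\<close>; countability of the bumps yields a common one.\<close>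
lemma L2L2_AE_zero_if_orthogonal_to_bumps:
  assumes \<Omega>: "open \<Omega>" "bounded \<Omega>" and w: "w \<in> L2L2 T \<Omega>"
    and orth: "\<And>v. v \<in> bumps \<Omega> \<Longrightarrow>
      AE t in lebesgue_on {0<..<T}. L2_inner (lebesgue_on \<Omega>) (w t) v = 0"
  shows "ae_zero T \<Omega> w"
proof -
  have "AE t in lebesgue_on {0<..<T}. \<forall>v\<in>bumps \<Omega>. L2_inner (lebesgue_on \<Omega>) (w t) v = 0"
    using orth countable_bumps by (subst AE_ball_countable) auto
  moreover have "AE t in lebesgue_on {0<..<T}. w t \<in> L2 (lebesgue_on \<Omega>)"
    using w by (simp add: bochner_L2_def)
  ultimately show ?thesis
    unfolding ae_zero_def
    by eventually_elim (rule L2_AE_zero_if_orthogonal_to_bumps[OF \<Omega>]; blast)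
qed

lemma bump_in_spaces:
  assumes \<Omega>: "open \<Omega>" "bounded \<Omega>" and v: "v \<in> bumps \<Omega>"
  shows "v \<in> test_functions \<Omega>" "v \<in> H10 \<Omega>" "v \<in> L2 (lebesgue_on \<Omega>)"
proof -
  show t: "v \<in> test_functions \<Omega>" using v bumps_subset_test_functions by blast
  show "v \<in> H10 \<Omega>" using t test_functions_subset_H10[OF \<Omega>] by blast
  show "v \<in> L2 (lebesgue_on \<Omega>)"
    using \<Omega> by (intro L2_continuous test_function_continuous[OF t]) auto
qed

lemma is_dt_dt: "y \<in> W_space T \<Omega> \<Longrightarrow> is_dt T \<Omega> y (dt T \<Omega> y)"
  unfolding dt_def by (rule someI_ex[of "is_dt T \<Omega> y"]) (simp add: W_space_def)

lemma is_dtt_dtt: "y \<in> W_space T \<Omega> \<Longrightarrow> is_dtt T \<Omega> y (dtt T \<Omega> y)"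
  unfolding dtt_def by (rule someI_ex[of "is_dtt T \<Omega> y"]) (simp add: W_space_def)

lemma is_wave_L2_wave_L2: "y \<in> Y_space T \<Omega> \<Longrightarrow> is_wave_L2 T \<Omega> y (wave_L2 T \<Omega> y)"
  unfolding wave_L2_def by (rule someI_ex[of "is_wave_L2 T \<Omega> y"]) (simp add: Y_space_def)

lemma is_init1_L2_init1_L2: "y \<in> Y_space T \<Omega> \<Longrightarrow> is_init1_L2 T \<Omega> y (init1_L2 T \<Omega> y)"
  unfolding init1_L2_def by (rule someI_ex[of "is_init1_L2 T \<Omega> y"]) (simp add: Y_space_def)

lemma Y_space_subset_W_space: "Y_space T \<Omega> \<subseteq> W_space T \<Omega>"
  by (auto simp: Y_space_def)

lemma dt_ae_zero:
  assumes \<Omega>: "open \<Omega>" "bounded \<Omega>" and y: "y \<in> W_space T \<Omega>" and y0: "ae_zero T \<Omega> y"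
  shows "ae_zero T \<Omega> (dt T \<Omega> y)"
proof (rule L2L2_AE_zero_if_orthogonal_to_bumps[OF \<Omega>])
  note dt = is_dt_dt[OF y, unfolded is_dt_def]
  show "dt T \<Omega> y \<in> L2L2 T \<Omega>" using dt by simp
  fix v assume v: "v \<in> bumps \<Omega>"
  note v' = bump_in_spaces[OF \<Omega> v]
  have "AE t in lebesgue_on {0<..<T}. L2_to_Hm1 \<Omega> (y t) v = 0"
    using y0 unfolding ae_zero_def L2_to_Hm1_def
    by eventually_elim (rule L2_inner_AE_zero_left)
  moreover have "integrable (lebesgue_on {0<..<T}) (\<lambda>t. L2_to_Hm1 \<Omega> (dt T \<Omega> y t) v)"
    unfolding L2_to_Hm1_def using dt v' by (intro L2L2_pairing_integrable) auto
  ultimately have "AE t in lebesgue_on {0<..<T}. L2_to_Hm1 \<Omega> (dt T \<Omega> y t) v = 0"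
    using weak_time_deriv_zero[of T \<Omega> "\<lambda>t. L2_to_Hm1 \<Omega> (y t)" "\<lambda>t. L2_to_Hm1 \<Omega> (dt T \<Omega> y t)" v] dt v'
    by simp
  then show "AE t in lebesgue_on {0<..<T}. L2_inner (lebesgue_on \<Omega>) (dt T \<Omega> y t) v = 0"
    by (simp add: L2_to_Hm1_def)
qed

text \<open>This determines \<open>dtt T \<Omega> y t\<close> only at the bumps. That is enough, because a square integrable
  function is determined by its pairings with the bumps (\<open>L2_AE_zero_if_orthogonal_to_bumps\<close>).\<close>
lemma dtt_ae_zero:
  assumes \<Omega>: "open \<Omega>" "bounded \<Omega>" and y: "y \<in> W_space T \<Omega>" and y0: "ae_zero T \<Omega> y"
    and v: "v \<in> bumps \<Omega>"
  shows "AE t in lebesgue_on {0<..<T}. dtt T \<Omega> y t v = 0"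
proof (rule weak_time_deriv_zero[where F = "\<lambda>t. L2_to_Hm1 \<Omega> (dt T \<Omega> y t)" and G = "dtt T \<Omega> y"])
  note dtt = is_dtt_dtt[OF y, unfolded is_dtt_def]
  note v' = bump_in_spaces[OF \<Omega> v]
  show "has_weak_time_deriv T \<Omega> (\<lambda>t. L2_to_Hm1 \<Omega> (dt T \<Omega> y t)) (dtt T \<Omega> y)" using dtt by simp
  show "AE t in lebesgue_on {0<..<T}. L2_to_Hm1 \<Omega> (dt T \<Omega> y t) v = 0"
    using dt_ae_zero[OF \<Omega> y y0] unfolding ae_zero_def L2_to_Hm1_def
    by eventually_elim (rule L2_inner_AE_zero_left)
  show "integrable (lebesgue_on {0<..<T}) (\<lambda>t. dtt T \<Omega> y t v)"
    using dtt v' by (intro L2Hm1_evaluation_integrable[OF \<Omega>]) auto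
  show "v \<in> H10 \<Omega>" by (rule v')
qed

lemma wave_L2_ae_zero:
  assumes \<Omega>: "open \<Omega>" "bounded \<Omega>" and y: "y \<in> Y_space T \<Omega>" and y0: "ae_zero T \<Omega> y"
  shows "ae_zero T \<Omega> (wave_L2 T \<Omega> y)"
proof (rule L2L2_AE_zero_if_orthogonal_to_bumps[OF \<Omega>])
  note f = is_wave_L2_wave_L2[OF y, unfolded is_wave_L2_def]
  show "wave_L2 T \<Omega> y \<in> L2L2 T \<Omega>" using f by simp
  fix v assume v: "v \<in> bumps \<Omega>"
  have yW: "y \<in> W_space T \<Omega>" using y Y_space_subset_W_space by blast
  have wave: "AE t in lebesgue_on {0<..<T}. \<forall>v\<in>H10 \<Omega>. wave T \<Omega> y t v = L2_to_Hm1 \<Omega> (wave_L2 T \<Omega> y t) v"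
    using f by simp
  show "AE t in lebesgue_on {0<..<T}. L2_inner (lebesgue_on \<Omega>) (wave_L2 T \<Omega> y t) v = 0"
    using wave dtt_ae_zero[OF \<Omega> yW y0 v] y0[unfolded ae_zero_def]
  proof eventually_elim
    case (elim t)
    have "laplacian \<Omega> (y t) v = 0"
      using grad_inner_AE_zero_left[OF \<Omega> elim(3)] by (simp add: laplacian_def)
    moreover have "wave T \<Omega> y t v = L2_to_Hm1 \<Omega> (wave_L2 T \<Omega> y t) v"
      using elim(1) bump_in_spaces(2)[OF \<Omega> v] by blast
    ultimately show ?case
      using elim(2) by (simp add: wave_def L2_to_Hm1_def)
  qed
qed

lemma H10_norm_zero: "open U \<Longrightarrow> bounded U \<Longrightarrow> H10_norm U (\<lambda>x. 0) = 0"
  by (rule H10_norm_AE_zero) auto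

lemma Hm1_zero: "(\<lambda>v. 0) \<in> Hm1 U"
  by (auto simp: Hm1_def intro: exI[of _ 0])

lemma Hm1_norm_zero:
  assumes U: "open U" "bounded U"
  shows "Hm1_norm U (\<lambda>v. 0) = 0"
proof -
  have "(\<lambda>x. 0) \<in> {v \<in> H10 U. H10_norm U v \<le> 1}"
    using test_functions_subset_H10[OF U] test_function_zero H10_norm_zero[OF U] by auto
  then have "{v \<in> H10 U. H10_norm U v \<le> 1} \<noteq> {}" by blast
  then show ?thesis unfolding Hm1_norm_def by simp
qed

lemma AE_interval_ex:
  assumes ae: "AE t in lebesgue_on {0<..<T}. P t" and d: "0 < d" "d \<le> T"
  shows "\<exists>t\<in>{0<..<d}. P (t::real)"
proof (rule ccontr)
  assume no: "\<not> ?thesis"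
  have "AE t in lebesgue. t \<in> {0<..<T} \<longrightarrow> P t" using ae by (simp add: AE_restrict_space_iff)
  then have "AE t in lebesgue. t \<notin> {0<..<d}"
    by eventually_elim (use no d in auto)
  then have "{0<..<d} \<in> null_sets lebesgue" by (simp add: completion.null_sets_iff_AE)
  then have "negligible {0<..<d}" by (simp add: negligible_iff_null_sets)
  then show False using open_not_negligible[of "{0<..<d}"] d by auto
qed

text \<open>The zero function is a continuous representative of \<open>y'\<close>, hence the chosen one, \<open>w\<close>, has the
  properties of a continuous representative too. It vanishes at each bump for almost all times, in
  particular for times arbitrarily close to \<open>0\<close>, and by continuity it does so at time \<open>0\<close>.\<close>
lemma init1_L2_AE_zero:
  assumes \<Omega>: "open \<Omega>" "bounded \<Omega>" and T: "0 < T"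
    and y: "y \<in> Y_space T \<Omega>" and y0: "ae_zero T \<Omega> y"
  shows "AE x in lebesgue_on \<Omega>. init1_L2 T \<Omega> y x = 0"
proof (rule L2_AE_zero_if_orthogonal_to_bumps[OF \<Omega>])
  note g = is_init1_L2_init1_L2[OF y, unfolded is_init1_L2_def]
  show "init1_L2 T \<Omega> y \<in> L2 (lebesgue_on \<Omega>)" using g by simp
  fix v assume v: "v \<in> bumps \<Omega>"
  note v' = bump_in_spaces[OF \<Omega> v]
  define u where "u = (\<lambda>t. L2_to_Hm1 \<Omega> (dt T \<Omega> y t))"
  define cr where "cr = continuous_representative T (Hm1 \<Omega>) (Hm1_norm \<Omega>) u"
  have yW: "y \<in> W_space T \<Omega>" using y Y_space_subset_W_space by blast
  have u0: "AE t in lebesgue_on {0<..<T}. u t = (\<lambda>v. 0)"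
    using dt_ae_zero[OF \<Omega> yW y0] unfolding ae_zero_def u_def L2_to_Hm1_def
    by eventually_elim (intro ext L2_inner_AE_zero_left)
  have "cr (\<lambda>t v. 0)"
    unfolding cr_def continuous_representative_def
  proof (intro conjI ballI)
    show "AE t in lebesgue_on {0<..<T}. Hm1_norm \<Omega> ((\<lambda>v. 0) - u t) = 0"
      using u0 by eventually_elim (simp add: fun_diff_def Hm1_norm_zero[OF \<Omega>])
  qed (simp_all add: Hm1_zero fun_diff_def Hm1_norm_zero[OF \<Omega>])
  then have "cr (SOME w. cr w)" by (rule someI[of cr])
  then obtain w where w: "cr w" and init1: "init1 T \<Omega> y = w 0"
    unfolding init1_def initial_value_def cr_def u_def by blast
  have wH: "w t \<in> Hm1 \<Omega>" if "t \<in> {0..T}" for t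
    using w that unfolding cr_def continuous_representative_def by blast
  have "((\<lambda>s. Hm1_norm \<Omega> (w s - w 0)) \<longlongrightarrow> 0) (at 0 within {0..T})"
    using w T unfolding cr_def continuous_representative_def by auto
  obtain K where K: "\<And>F. F \<in> Hm1 \<Omega> \<Longrightarrow> \<bar>F v\<bar> \<le> K * Hm1_norm \<Omega> F"
    using Hm1_evaluation_bound[OF \<Omega> v'(1)] by blast
  have "AE t in lebesgue_on {0<..<T}. Hm1_norm \<Omega> (w t - u t) = 0"
    using w unfolding cr_def continuous_representative_def by blast
  then have w0: "AE t in lebesgue_on {0<..<T}. w t v = 0"
    using u0 AE_space
  proof eventually_elim
    case (elim t)
    then have "Hm1_norm \<Omega> (w t) = 0" by (simp add: fun_diff_def)
    then show ?case using K[OF wH, of t] elim(3) by simp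
  qed
  have "w 0 v = 0"
  proof (rule ccontr)
    assume ne: "w 0 v \<noteq> 0"
    have "((\<lambda>s. K * Hm1_norm \<Omega> (w s - w 0)) \<longlongrightarrow> K * 0) (at 0 within {0..T})"
      by (intro tendsto_intros) fact
    then have "\<forall>\<^sub>F s in at 0 within {0..T}. K * Hm1_norm \<Omega> (w s - w 0) < \<bar>w 0 v\<bar>"
      using ne by (intro order_tendstoD(2)[where y = "K * 0"]) auto
    then obtain d where d: "d > 0"
      "\<And>s. s \<in> {0..T} \<Longrightarrow> s \<noteq> 0 \<Longrightarrow> dist s 0 < d \<Longrightarrow> K * Hm1_norm \<Omega> (w s - w 0) < \<bar>w 0 v\<bar>"
      unfolding eventually_at by blast
    obtain s where s: "s \<in> {0<..<min d T}" "w s v = 0"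
      using AE_interval_ex[OF w0, of "min d T"] d(1) T by auto
    then have "\<bar>(w s - w 0) v\<bar> \<le> K * Hm1_norm \<Omega> (w s - w 0)"
      using T by (intro K Hm1_diff wH) auto
    also have "\<dots> < \<bar>w 0 v\<bar>" using s by (intro d(2)) auto
    finally show False using s(2) by simp
  qed
  then show "L2_inner (lebesgue_on \<Omega>) (init1_L2 T \<Omega> y) v = 0"
    using g v'(2) init1 by (simp add: L2_to_Hm1_def)
qed

section \<open>The inf-sup estimate\<close>
lemma L2L2_inner_ae_zero_right:
  "ae_zero T \<Omega> g \<Longrightarrow> L2L2_inner T \<Omega> f g = 0"
  unfolding ae_zero_def L2L2_inner_def
  by (intro integral_eq_zero_AE) (auto elim!: eventually_mono intro: L2_inner_AE_zero_right)

lemma L2L2_norm_power2: "(L2L2_norm T \<Omega> f)\<^sup>2 = L2L2_inner T \<Omega> f f"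
  unfolding L2L2_norm_def L2L2_inner_def
  by (intro real_sqrt_pow2 integral_nonneg_AE AE_I2 L2_inner_self_nonneg)

lemma Lambda_norm_power2:
  "(Lambda_norm T \<Omega> l)\<^sup>2 = (L2L2_norm T \<Omega> (fst l))\<^sup>2 + (L2_norm (lebesgue_on \<Omega>) (snd l))\<^sup>2"
  by (simp add: Lambda_norm_def)

lemma bform_AE_zero:
  assumes "ae_zero T \<Omega> (fst l)" "AE x in lebesgue_on \<Omega>. snd l x = 0"
  shows "bform T \<Omega> y l = 0"
  using assms by (simp add: bform_def L2L2_inner_ae_zero_right L2_inner_AE_zero_right)

lemma Lambda_norm_AE_zero:
  assumes "ae_zero T \<Omega> (fst l)" "AE x in lebesgue_on \<Omega>. snd l x = 0"
  shows "Lambda_norm T \<Omega> l = 0"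
proof -
  have "(Lambda_norm T \<Omega> l)\<^sup>2 = 0"
    using assms unfolding Lambda_norm_power2 L2L2_norm_power2 L2_norm_power2
    by (simp add: L2L2_inner_ae_zero_right L2_inner_AE_zero_right)
  then show ?thesis by simp
qed

lemma obs_norm_nonneg: "0 \<le> obs_norm T \<Omega>s \<Gamma> y"
  unfolding obs_norm_def by (intro real_sqrt_ge_zero integral_nonneg_AE) auto

text \<open>Here \<open>y\<close> is tested with its own pair \<open>l\<close>. If the norm \<open>N\<close> of \<open>l\<close> is zero, both sides are zero,
  whatever the denominator; otherwise \<open>\<rho> * N\<^sup>2\<close> keeps the denominator positive.\<close>
lemma quotient_lower_bound:
  assumes \<Omega>: "open \<Omega>" "bounded \<Omega>"
    and init0: "AE x in lebesgue_on \<Omega>. init0 T \<Omega> y x = 0"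
    and obs: "obs_norm T \<Omega>s \<Gamma> y \<le> C * Y_norm T \<Omega> y"
    and \<rho>: "0 < \<rho>"
  defines "l \<equiv> (wave_L2 T \<Omega> y, init1_L2 T \<Omega> y)"
  shows "1 / sqrt (C\<^sup>2 + \<rho>) * Lambda_norm T \<Omega> l
    \<le> bform T \<Omega> y l / Y_weighted_norm T \<Omega> \<Omega>s \<Gamma> \<alpha> \<rho> y"
proof -
  define N where "N = Lambda_norm T \<Omega> l"
  have N: "N \<ge> 0" by (simp add: N_def Lambda_norm_def)
  have N2: "N\<^sup>2 = (L2L2_norm T \<Omega> (wave_L2 T \<Omega> y))\<^sup>2 + (L2_norm (lebesgue_on \<Omega>) (init1_L2 T \<Omega> y))\<^sup>2"
    by (simp add: N_def Lambda_norm_power2 l_def)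
  have b: "bform T \<Omega> y l = N\<^sup>2"
    by (simp add: N2 bform_def l_def L2L2_norm_power2 L2_norm_power2)
  note i0 = H10_norm_AE_zero[OF \<Omega> init0]
  have "Y_norm T \<Omega> y = N" using N by (simp add: Y_norm_def i0 flip: N2)
  then have "(obs_norm T \<Omega>s \<Gamma> y)\<^sup>2 \<le> (C * N)\<^sup>2"
    using obs obs_norm_nonneg by (intro power_mono) auto
  then have "(obs_norm T \<Omega>s \<Gamma> y)\<^sup>2 + \<rho> * N\<^sup>2 \<le> (C\<^sup>2 + \<rho>) * N\<^sup>2"
    by (simp add: power_mult_distrib distrib_right)
  moreover have Yw: "Y_weighted_norm T \<Omega> \<Omega>s \<Gamma> \<alpha> \<rho> y = sqrt ((obs_norm T \<Omega>s \<Gamma> y)\<^sup>2 + \<rho> * N\<^sup>2)"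
    by (simp add: Y_weighted_norm_def i0 N2)
  ultimately have upper: "Y_weighted_norm T \<Omega> \<Omega>s \<Gamma> \<alpha> \<rho> y \<le> sqrt (C\<^sup>2 + \<rho>) * N"
    using N by (metis real_sqrt_abs real_sqrt_le_mono real_sqrt_mult abs_of_nonneg)
  show ?thesis
  proof (cases "N = 0")
    case False
    with N have "N > 0" by simp
    have "0 < \<rho> * N\<^sup>2" using \<rho> \<open>N > 0\<close> by simp
    then have pos: "0 < Y_weighted_norm T \<Omega> \<Omega>s \<Gamma> \<alpha> \<rho> y"
      unfolding Yw by (simp add: add_nonneg_pos)
    have "1 / sqrt (C\<^sup>2 + \<rho>) * N = N\<^sup>2 / (sqrt (C\<^sup>2 + \<rho>) * N)"
      using \<open>N > 0\<close> by (simp add: power2_eq_square)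
    also have "\<dots> \<le> N\<^sup>2 / Y_weighted_norm T \<Omega> \<Omega>s \<Gamma> \<alpha> \<rho> y"
      using upper pos \<open>N > 0\<close> \<rho> by (intro divide_left_mono mult_pos_pos) (auto simp: add_nonneg_pos)
    finally show ?thesis by (simp add: b flip: N_def)
  qed (simp add: b flip: N_def)
qed

theorem lemma4p2:
  fixes \<Omega> \<Omega>s \<Gamma> :: "'a::euclidean_space set"
    and T Cobs :: real
    and Yh :: "(real \<Rightarrow> 'a \<Rightarrow> real) set"
  assumes "\<Omega> \<noteq> {}" "open \<Omega>" "connected \<Omega>" "bounded \<Omega>" "piecewise_lipschitz_boundary \<Omega>"
    and "\<Omega>s \<noteq> {}" "open \<Omega>s" "lipschitz_boundary \<Omega>s" "compact (closure \<Omega>s)" "closure \<Omega>s \<subseteq> \<Omega>"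
    and "\<Gamma> \<subseteq> frontier \<Omega>s" "\<Gamma> \<in> sets surface_measure"
    and "0 < T"
    and "0 < Cobs" "\<forall>y\<in>Y_space T \<Omega>. obs_norm T \<Omega>s \<Gamma> y \<le> Cobs * Y_norm T \<Omega> y"
    and "conforming_discretization T \<Omega> Yh"
  shows "Lambda_h T \<Omega> Yh \<subseteq> Lambda_space T \<Omega> \<and>
    (\<forall>\<alpha>>0. \<forall>\<rho>>0. \<forall>l\<in>Lambda_h T \<Omega> Yh.
      (SUP y\<in>{y \<in> Yh. \<not> ae_zero T \<Omega> y}.
         ereal (bform T \<Omega> y l / Y_weighted_norm T \<Omega> \<Omega>s \<Gamma> \<alpha> \<rho> y))
      \<ge> ereal (1 / sqrt (Cobs\<^sup>2 + \<rho>) * Lambda_norm T \<Omega> l))"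
proof (intro conjI allI impI ballI)
  have Yh: "Yh \<subseteq> Y_space T \<Omega>" and nontrivial: "\<exists>y\<in>Yh. \<not> ae_zero T \<Omega> y"
    using assms by (simp_all add: conforming_discretization_def)
  show "Lambda_h T \<Omega> Yh \<subseteq> Lambda_space T \<Omega>"
    using Yh is_wave_L2_wave_L2 is_init1_L2_init1_L2
    by (fastforce simp: Lambda_h_def Lambda_space_def is_wave_L2_def is_init1_L2_def)
  fix \<alpha> \<rho> :: real and l assume pos: "0 < \<alpha>" "0 < \<rho>" and "l \<in> Lambda_h T \<Omega> Yh"
  then obtain y where y: "y \<in> Yh" "AE x in lebesgue_on \<Omega>. init0 T \<Omega> y x = 0"
    and l: "l = (wave_L2 T \<Omega> y, init1_L2 T \<Omega> y)"
    by (auto simp: Lambda_h_def)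
  have yY: "y \<in> Y_space T \<Omega>" using y Yh by blast
  show "ereal (1 / sqrt (Cobs\<^sup>2 + \<rho>) * Lambda_norm T \<Omega> l) \<le>
    (SUP y\<in>{y \<in> Yh. \<not> ae_zero T \<Omega> y}.
         ereal (bform T \<Omega> y l / Y_weighted_norm T \<Omega> \<Omega>s \<Gamma> \<alpha> \<rho> y))"
  proof (cases "ae_zero T \<Omega> y")
    \<comment> \<open>Now \<open>y\<close> itself does not take part in the supremum, but \<open>l\<close> is zero as an element of \<open>\<Lambda>\<close>, and
      any \<open>z\<close> that takes part has the quotient \<open>0\<close>.\<close>
    case True
    have l0: "ae_zero T \<Omega> (fst l)" "AE x in lebesgue_on \<Omega>. snd l x = 0"
      using wave_L2_ae_zero[OF _ _ yY True] init1_L2_AE_zero[OF _ _ _ yY True] assms(2,4,13)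
      by (simp_all add: l)
    obtain z where "z \<in> Yh" "\<not> ae_zero T \<Omega> z" using nontrivial by blast
    then show ?thesis
      by (intro SUP_upper2[of z]) (simp_all add: bform_AE_zero[OF l0] Lambda_norm_AE_zero[OF l0])
  next
    case False
    have "1 / sqrt (Cobs\<^sup>2 + \<rho>) * Lambda_norm T \<Omega> l
        \<le> bform T \<Omega> y l / Y_weighted_norm T \<Omega> \<Omega>s \<Gamma> \<alpha> \<rho> y"
      unfolding l using assms(2,4,15) y(2) yY pos by (intro quotient_lower_bound) auto
    then show ?thesis
      using y False by (intro SUP_upper2[of y]) auto
  qed
qed

end
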